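(* Let $G$ be a finite group of order $N=|G|$ with identity $e$. Let $\{U(f)\}$ and $\{V(f)\}$ be projective unitary representations of $G$ on finite-dimensional complex Hilbert spaces $\mathcal{H}_A$ and $\mathcal{H}_B$, with factor systems $\mu(f,g)$ and $\nu(f,g)$ and with $U(e)=I_A$, $V(e)=I_B$, so that $\{U(f)\otimes V(f)\}$ is a projective unitary representation of $G$ with factor system $\gamma(f,g)=\mu(f,g)\nu(f,g)$. Let the inequivalent irreducible representations for the factor system $\gamma$ be $\{D^{(\lambda)}(f):\lambda=1,\dots,\kappa\}$, with $D^{(\lambda)}$ of dimension $d_\lambda$. Let $c(f)$, $f\in G$, be complex numbers and $\mathcal{U}=\sum_{f\in G}c(f)\,U(f)\otimes V(f)$. Then: (a) The following three statements are equivalent: (i) The operator $C$ on the Hilbert space $\mathcal{H}_b$ with orthonormal basis $\{|g\rangle:g\in G\}$, defined by $\langle g|C|f\rangle=\gamma(g,g^{-1}f)\,c(g^{-1}f)$, is unitary. (ii) The $c(f)$ are given by $$c(f)=\sum_{\lambda=1}^{\kappa}\frac{d_\lambda}{N}\sum_{j,k=1}^{d_\lambda}\left[D^{(\lambda)}_{jk}(f)\right]^*\mathcal{R}^{(\lambda)}_{jk}\qquad(f\in G)$$ for some collection $\{\mathcal{R}^{(\lambda)}\}$, where each $\mathcal{R}^{(\lambda)}$ is a $d_\lambda\times d_\lambda$ unitary matrix. (iii) The $c(f)$ satisfy $$\sum_{f\in G}\gamma^*(f,g)\,c^*(f)\,c(fg)=\delta(e,g)\qquad\text{for all }g\in G,$$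 where $\delta(e,g)$ is $1$ if $g=e$ and $0$ otherwise. (b) Each of the three statements in (a) implies that $\mathcal{U}$ is unitary and that the double-unitary protocol described in the context carries it out (deterministically implements it). (c) If $\mathcal{U}$ is unitary and the operators $U(f)\otimes V(f)$, $f\in G$, are linearly independent, then all three statements in (a) hold. (d) If $\mathcal{U}$ is unitary and the $U(f)\otimes V(f)$ are linearly dependent (so the $c(f)$ are not uniquely determined by $\mathcal{U}$), there exists at least one choice of complex numbers $c'(f)$ with $\mathcal{U}=\sum_{f\in G}c'(f)\,U(f)\otimes V(f)$ such that the statements in (a) hold for $c'(f)$ in place of $c(f)$.
   Context: A projective unitary representation of $G$ with factor system $\mu$ is a family of unitary operators $U(f)$, $f\in G$, with $U(f)U(g)=\mu(f,g)U(fg)$ for all $f,g\in G$, where the $\mu(f,g)$ are complex numbers of magnitude 1. $\{D^{(\lambda)}\}$ is a fixed complete list of inequivalent irreducible projective unitary matrix representations with factor system $\gamma$, with entries $D^{(\lambda)}_{jk}(f)$. Double-unitary protocol. Ancillary systems $a,b$ have Hilbert spaces $\mathcal{H}_a,\mathcal{H}_b$ each with orthonormal (standard) basis $\{|f\rangle:f\in G\}$. Fix a unitary $F$ on $\mathcal{H}_a$ all of whose matrix elements $\langle h|F|f\rangle$ in the standard basis have magnitude $|G|^{-1/2}$, and a complex number $z$ with $|z|=|G|^{-1/2}$. For $h\in G$ let $Z(h)$ be the diagonal unitary on $\mathcal{H}_b$ with $Z(h)|f\rangle=z\,\langle h|F|f\rangle^{-1}|f\rangle$. The input is an arbitrary state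 $|\Psi\rangle\in\mathcal{H}_A\otimes\mathcal{H}_B$, and $ab$ starts in the state $|G|^{-1/2}\sum_{f\in G}|f\rangle_a\otimes|f\rangle_b$. The steps are, in order: 1. Apply the controlled unitary $\sum_f|f\rangle\langle f|_a\otimes U(f)_A$. 2. Apply $F$ to $a$ and measure $a$ in the standard basis, with outcome $h$, sent to $B$'s side. 3. Apply $Z(h)$ to $b$. 4. Apply $\sum_f|f\rangle\langle f|_b\otimes V(f)_B$, then $C$ on $b$, then $\sum_g|g\rangle\langle g|_b\otimes V(g)^\dagger_B$. 5. Measure $b$ in the standard basis, with outcome $g$, sent to $A$'s side. 6. Apply $U(g)^\dagger$ to $A$. The protocol deterministically implements $\mathcal{U}$ if for every pair of outcomes $(h,g)$ the resulting (Kraus) operator on $\mathcal{H}_A\otimes\mathcal{H}_B$ is a scalar multiple of $\mathcal{U}$, the scalar being independent of the input; thus the output is $\mathcal{U}|\Psi\rangle$ (up to phase) with probability 1. *)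

theory Defs
  imports "Jordan_Normal_Form.Schur_Decomposition"
begin

text \<open>
  The space \<open>H\<^sub>A\<close> is \<open>carrier_vec nA\<close> and \<open>H\<^sub>B\<close> is \<open>carrier_vec nB\<close>, i.e. operators on them are
  written as matrices in fixed orthonormal bases. The spaces with orthonormal basis indexed by a
  group \<open>G\<close> are not renumbered: an operator \<open>K\<close> on such a space is given by its matrix elements
  \<open>K g f = \<langle>g|K|f\<rangle>\<close> for \<open>g, f \<in> carrier G\<close>; values outside the carrier are irrelevant.
\<close>

definition unitary_mat :: "nat \<Rightarrow> complex mat \<Rightarrow> bool" where
  "unitary_mat n A \<longleftrightarrow>
     A \<in> carrier_mat n n \<and> mat_adjoint A * A = 1\<^sub>m n \<and> A * mat_adjoint A = 1\<^sub>m n"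

definition unitary_on :: "'g set \<Rightarrow> ('g \<Rightarrow> 'g \<Rightarrow> complex) \<Rightarrow> bool" where
  "unitary_on S K \<longleftrightarrow>
     (\<forall>f\<in>S. \<forall>f'\<in>S. (\<Sum>g\<in>S. cnj (K g f) * K g f') = (if f = f' then 1 else 0)) \<and>
     (\<forall>g\<in>S. \<forall>g'\<in>S. (\<Sum>f\<in>S. K g f * cnj (K g' f)) = (if g = g' then 1 else 0))"

text \<open>
  The basis vector \<open>|i\<rangle> \<otimes> |j\<rangle>\<close> of \<open>H\<^sub>A \<otimes> H\<^sub>B\<close> has index \<open>i * nB + j\<close>.
\<close>

definition kronecker :: "complex mat \<Rightarrow> complex mat \<Rightarrow> complex mat" where
  "kronecker A B =
     mat (dim_row A * dim_row B) (dim_col A * dim_col B)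
       (\<lambda>(i, j). A $$ (i div dim_row B, j div dim_col B) * B $$ (i mod dim_row B, j mod dim_col B))"

definition proj_unitary_rep ::
  "('g, 'x) monoid_scheme \<Rightarrow> nat \<Rightarrow> ('g \<Rightarrow> 'g \<Rightarrow> complex) \<Rightarrow> ('g \<Rightarrow> complex mat) \<Rightarrow> bool" where
  "proj_unitary_rep G n \<mu> U \<longleftrightarrow>
     (\<forall>f\<in>carrier G. unitary_mat n (U f)) \<and>
     (\<forall>f\<in>carrier G. \<forall>g\<in>carrier G.
        cmod (\<mu> f g) = 1 \<and> U f * U g = \<mu> f g \<cdot>\<^sub>m U (f \<otimes>\<^bsub>G\<^esub> g))"

definition irreducible_rep ::
  "('g, 'x) monoid_scheme \<Rightarrow> nat \<Rightarrow> ('g \<Rightarrow> complex mat) \<Rightarrow> bool" where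
  "irreducible_rep G n D \<longleftrightarrow>
     n > 0 \<and>
     (\<forall>W. VectorSpace.subspace class_ring W (module_vec TYPE(complex) n) \<and>
          (\<forall>f\<in>carrier G. \<forall>w\<in>W. D f *\<^sub>v w \<in> W)
        \<longrightarrow> W = {0\<^sub>v n} \<or> W = carrier_vec n)"

definition equivalent_reps ::
  "('g, 'x) monoid_scheme \<Rightarrow> nat \<Rightarrow> ('g \<Rightarrow> complex mat) \<Rightarrow> nat \<Rightarrow> ('g \<Rightarrow> complex mat) \<Rightarrow> bool" where
  "equivalent_reps G n D n' D' \<longleftrightarrow>
     n = n' \<and>
     (\<exists>S\<in>carrier_mat n n. invertible_mat S \<and> (\<forall>f\<in>carrier G. S * D f = D' f * S))"

definition complete_irreps ::
  "('g, 'x) monoid_scheme \<Rightarrow> ('g \<Rightarrow> 'g \<Rightarrow> complex) \<Rightarrow>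
   nat \<Rightarrow> (nat \<Rightarrow> nat) \<Rightarrow> (nat \<Rightarrow> 'g \<Rightarrow> complex mat) \<Rightarrow> bool" where
  "complete_irreps G \<gamma> \<kappa> d D \<longleftrightarrow>
     (\<forall>l\<in>{1..\<kappa>}. proj_unitary_rep G (d l) \<gamma> (D l) \<and> irreducible_rep G (d l) (D l)) \<and>
     (\<forall>l\<in>{1..\<kappa>}. \<forall>l'\<in>{1..\<kappa>}. l \<noteq> l' \<longrightarrow> \<not> equivalent_reps G (d l) (D l) (d l') (D l')) \<and>
     (\<forall>n E. proj_unitary_rep G n \<gamma> E \<and> irreducible_rep G n E \<longrightarrow>
        (\<exists>l\<in>{1..\<kappa>}. equivalent_reps G n E (d l) (D l)))"

text \<open>
  The operator \<open>\<Sum>\<^sub>f c(f) T(f)\<close> on \<open>carrier_vec n\<close>.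
\<close>

definition op_combination ::
  "('g, 'x) monoid_scheme \<Rightarrow> nat \<Rightarrow> ('g \<Rightarrow> complex mat) \<Rightarrow> ('g \<Rightarrow> complex) \<Rightarrow> complex mat" where
  "op_combination G n T c = mat n n (\<lambda>(i, j). \<Sum>f\<in>carrier G. c f * T f $$ (i, j))"

text \<open>
  Linear independence of the indexed family \<open>T(f)\<close>, \<open>f \<in> G\<close>; a repeated operator makes the
  family dependent.
\<close>

definition lin_indep_ops ::
  "('g, 'x) monoid_scheme \<Rightarrow> nat \<Rightarrow> ('g \<Rightarrow> complex mat) \<Rightarrow> bool" where
  "lin_indep_ops G n T \<longleftrightarrow>
     (\<forall>a. op_combination G n T a = 0\<^sub>m n n \<longrightarrow> (\<forall>f\<in>carrier G. a f = 0))"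

definition coeff_operator ::
  "('g, 'x) monoid_scheme \<Rightarrow> ('g \<Rightarrow> 'g \<Rightarrow> complex) \<Rightarrow> ('g \<Rightarrow> complex) \<Rightarrow> 'g \<Rightarrow> 'g \<Rightarrow> complex" where
  "coeff_operator G \<gamma> c g f =
     \<gamma> g (inv\<^bsub>G\<^esub> g \<otimes>\<^bsub>G\<^esub> f) * c (inv\<^bsub>G\<^esub> g \<otimes>\<^bsub>G\<^esub> f)"

definition unitary_coeff_operator ::
  "('g, 'x) monoid_scheme \<Rightarrow> ('g \<Rightarrow> 'g \<Rightarrow> complex) \<Rightarrow> ('g \<Rightarrow> complex) \<Rightarrow> bool" where
  "unitary_coeff_operator G \<gamma> c \<longleftrightarrow> unitary_on (carrier G) (coeff_operator G \<gamma> c)"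

definition unitary_irrep_expansion ::
  "('g, 'x) monoid_scheme \<Rightarrow> nat \<Rightarrow> (nat \<Rightarrow> nat) \<Rightarrow> (nat \<Rightarrow> 'g \<Rightarrow> complex mat) \<Rightarrow>
   ('g \<Rightarrow> complex) \<Rightarrow> bool" where
  "unitary_irrep_expansion G \<kappa> d D c \<longleftrightarrow>
     (\<exists>R. (\<forall>l\<in>{1..\<kappa>}. unitary_mat (d l) (R l)) \<and>
        (\<forall>f\<in>carrier G.
           c f = (\<Sum>l=1..\<kappa>. of_nat (d l) / of_nat (Coset.order G) *
                    (\<Sum>j<d l. \<Sum>k<d l. cnj (D l f $$ (j, k)) * R l $$ (j, k)))))"

definition orthonormal_coeffs ::
  "('g, 'x) monoid_scheme \<Rightarrow> ('g \<Rightarrow> 'g \<Rightarrow> complex) \<Rightarrow> ('g \<Rightarrow> complex) \<Rightarrow> bool" where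
  "orthonormal_coeffs G \<gamma> c \<longleftrightarrow>
     (\<forall>g\<in>carrier G.
        (\<Sum>f\<in>carrier G. cnj (\<gamma> f g) * cnj (c f) * c (f \<otimes>\<^bsub>G\<^esub> g))
          = (if g = \<one>\<^bsub>G\<^esub> then 1 else 0))"

text \<open>
  The branch of the double-unitary protocol with measurement outcomes \<open>h\<close> (on \<open>a\<close>) and \<open>g\<close>
  (on \<open>b\<close>), applied to the input \<open>\<Psi>\<close>; the result is the unnormalised output vector, i.e. the Kraus
  operator of this pair of outcomes applied to \<open>\<Psi>\<close>. A joint vector
  \<open>\<Sum> |f\<rangle>\<^sub>a \<otimes> |f'\<rangle>\<^sub>b \<otimes> \<phi>(f, f')\<close> of \<open>a\<close>, \<open>b\<close> and \<open>H\<^sub>A \<otimes> H\<^sub>B\<close> is written as the family \<open>\<phi>\<close> of its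
  components in \<open>H\<^sub>A \<otimes> H\<^sub>B\<close>, and likewise for \<open>b\<close> alone once \<open>a\<close> is measured. Outcome \<open>h\<close> of a
  standard-basis measurement applies the bra \<open>\<langle>h|\<close>, i.e. selects the component at \<open>h\<close>.
\<close>

definition protocol_branch ::
  "('g, 'x) monoid_scheme \<Rightarrow> nat \<Rightarrow> nat \<Rightarrow> ('g \<Rightarrow> complex mat) \<Rightarrow> ('g \<Rightarrow> complex mat) \<Rightarrow>
   ('g \<Rightarrow> 'g \<Rightarrow> complex) \<Rightarrow> complex \<Rightarrow> ('g \<Rightarrow> 'g \<Rightarrow> complex) \<Rightarrow> 'g \<Rightarrow> 'g \<Rightarrow> complex vec \<Rightarrow> complex vec" where
  "protocol_branch G nA nB U V F z C h g \<Psi> =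
    (let vsum = (\<lambda>v. finsum_vec TYPE(complex) (nA * nB) v (carrier G));
         onA = (\<lambda>X. kronecker X (1\<^sub>m nB));
         onB = (\<lambda>Y. kronecker (1\<^sub>m nA) Y);
         init = (\<lambda>f f'. (if f = f' then complex_of_real (1 / sqrt (real (Coset.order G))) else 0) \<cdot>\<^sub>v \<Psi>);
         ctrlU = (\<lambda>f f'. onA (U f) *\<^sub>v init f f');
         afterF = (\<lambda>k f'. vsum (\<lambda>f. F k f \<cdot>\<^sub>v ctrlU f f'));
         outcome_a = (\<lambda>f'. afterF h f');
         afterZ = (\<lambda>f'. (z * inverse (F h f')) \<cdot>\<^sub>v outcome_a f');
         ctrlV = (\<lambda>f'. onB (V f') *\<^sub>v afterZ f');
         afterC = (\<lambda>k. vsum (\<lambda>f'. C k f' \<cdot>\<^sub>v ctrlV f'));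
         ctrlVdag = (\<lambda>k. onB (mat_adjoint (V k)) *\<^sub>v afterC k);
         outcome_b = ctrlVdag g
     in onA (mat_adjoint (U g)) *\<^sub>v outcome_b)"

definition deterministically_implements ::
  "('g, 'x) monoid_scheme \<Rightarrow> nat \<Rightarrow> nat \<Rightarrow> ('g \<Rightarrow> complex mat) \<Rightarrow> ('g \<Rightarrow> complex mat) \<Rightarrow>
   ('g \<Rightarrow> 'g \<Rightarrow> complex) \<Rightarrow> complex \<Rightarrow> ('g \<Rightarrow> 'g \<Rightarrow> complex) \<Rightarrow> complex mat \<Rightarrow> bool" where
  "deterministically_implements G nA nB U V F z C \<U> \<longleftrightarrow>
     (\<forall>h\<in>carrier G. \<forall>g\<in>carrier G. \<exists>s. \<forall>\<Psi>\<in>carrier_vec (nA * nB).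
        protocol_branch G nA nB U V F z C h g \<Psi> = s \<cdot>\<^sub>v (\<U> *\<^sub>v \<Psi>))"

definition admissible_ancilla_gates ::
  "('g, 'x) monoid_scheme \<Rightarrow> ('g \<Rightarrow> 'g \<Rightarrow> complex) \<Rightarrow> complex \<Rightarrow> bool" where
  "admissible_ancilla_gates G F z \<longleftrightarrow>
     unitary_on (carrier G) F \<and>
     (\<forall>h\<in>carrier G. \<forall>f\<in>carrier G. cmod (F h f) = 1 / sqrt (real (Coset.order G))) \<and>
     cmod z = 1 / sqrt (real (Coset.order G))"

end

theory Submission
  imports Defs "Jordan_Normal_Form.Spectral_Radius"
begin

text \<open>
  For a projective unitary representation \<open>E\<close> with factor system \<open>\<gamma>\<close> write \<open>L\<^sub>E(c) = \<Sum>\<^sub>f c(f) E(f)\<close>.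
  Then \<open>L\<^sub>E(c)\<^sup>\<dagger> L\<^sub>E(c) = L\<^sub>E(q)\<close>, where \<open>q(g)\<close> is the left-hand side of (iii); so (iii), which says
  \<open>q = \<delta>\<^sub>e\<close>, makes \<open>L\<^sub>E(c)\<close> unitary for every \<open>E\<close>. The operator \<open>C\<close> of (i) is \<open>L\<^sub>E(c)\<close> for the
  twisted right regular representation, on which \<open>L\<^sub>E\<close> is injective. Every \<open>E\<close> splits orthogonally
  into irreducibles, so a function killed by all \<open>L\<close> of irreducibles vanishes; together with Schur
  orthogonality this inverts the Fourier transform, and (ii) says that \<open>L\<close> of \<open>c\<close> is unitary on
  each irreducible, with \<open>R\<^sup>\<lambda>\<close> as its value there. For (d), keep \<open>R\<^sup>\<lambda>\<close> for
  those \<open>\<lambda>\<close> that occur in \<open>U \<otimes> V\<close>, where it is automatically unitary, and replace it by the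
  identity for the others, which do not affect \<open>\<U>\<close>.
\<close>

text \<open>Complete reducibility is never stated as a decomposition. It enters as a vanishing
  criterion, proved by induction on the dimension: \<open>op_combination\<close> of \<open>u\<close>
  on \<open>E\<close> is zero once each \<open>D l\<close> either gives zero itself or has no
  nonzero intertwiner into \<open>E\<close>. The first alternative serves Fourier injectivity, the
  second serves (d), where coefficients are altered only on irreducibles that do not occur. For the
  induction to stay among matrix representations, an invariant subspace is replaced by an isometry
  \<open>J\<close> onto it and \<open>E\<close> by \<open>J\<^sup>\<dagger> E J\<close>; unitarity
  makes the complement invariant too. Dimensions are compared through traces of the projections
  \<open>J J\<^sup>\<dagger>\<close>. That \<open>\<delta>\<^sub>e\<close> is sent to the identity
  by all representations at once comes from the normalisation: \<open>U(e) = I\<close> and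
  \<open>V(e) = I\<close> force \<open>\<gamma>(g,e) = 1\<close>, and this in turn forces
  \<open>E(e) = I\<close> for every \<open>E\<close> with factor system \<open>\<gamma>\<close>. The
  weights \<open>d\<^sub>\<lambda>/N\<close> in (ii) are the reciprocals of the norms
  \<open>N/d\<^sub>\<lambda>\<close> in Schur orthogonality.\<close>

lemma index_mult_mat_sum:
  assumes "A \<in> carrier_mat n m" "B \<in> carrier_mat m k" "i < n" "j < k"
  shows "(A * B) $$ (i, j) = (\<Sum>l<m. A $$ (i, l) * B $$ (l, j))"
  using assms by (auto simp: scalar_prod_def atLeast0LessThan intro!: sum.cong)

lemma index_mult_mat_vec_sum:
  assumes "A \<in> carrier_mat n m" "v \<in> carrier_vec m" "i < n"
  shows "(A *\<^sub>v v) $ i = (\<Sum>l<m. A $$ (i, l) * v $ l)"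
  using assms by (auto simp: scalar_prod_def atLeast0LessThan intro!: sum.cong)

lemma mult_mat_assoc_dim:
  fixes A B C :: "'a::semiring_0 mat"
  assumes "dim_col A = dim_row B" "dim_col B = dim_row C"
  shows "A * B * C = A * (B * C)"
  by (rule assoc_mult_mat[of _ "dim_row A" "dim_row B" _ "dim_row C" _ "dim_col C"])
    (use assms in auto)

lemma eq_mat_if_eq_mult_vec:
  assumes "A \<in> carrier_mat n m" "B \<in> carrier_mat n m"
    and eq: "\<And>v. v \<in> carrier_vec m \<Longrightarrow> A *\<^sub>v v = B *\<^sub>v v"
  shows "A = (B :: 'a::comm_semiring_1 mat)"
proof (rule eq_matI)
  fix i j assume "i < dim_row B" "j < dim_col B"
  then have ij: "i < n" "j < m" using assms by auto
  have *: "X $$ (i, j) = (X *\<^sub>v unit_vec m j) $ i" if "X \<in> carrier_mat n m" for X :: "'a mat"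
    using that ij by simp
  show "A $$ (i, j) = B $$ (i, j)"
    using *[OF assms(1)] *[OF assms(2)] eq[of "unit_vec m j"] by simp
qed (use assms in auto)

subsection \<open>Adjoints and isometries\<close>

lemma dim_mat_adjoint [simp]:
  "dim_row (mat_adjoint A) = dim_col A" "dim_col (mat_adjoint A) = dim_row A"
  unfolding mat_adjoint_def by auto

lemma mat_adjoint_carrier [simp]:
  "A \<in> carrier_mat n m \<Longrightarrow> mat_adjoint A \<in> carrier_mat m n"
  by (intro carrier_matI) (auto dest: carrier_matD)

lemma index_mat_adjoint [simp]:
  fixes A :: "complex mat"
  assumes "i < dim_col A" "j < dim_row A"
  shows "mat_adjoint A $$ (i, j) = cnj (A $$ (j, i))"
  using assms unfolding mat_adjoint_def by (auto simp: mat_of_rows_def)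

lemma mat_adjoint_adjoint [simp]: "mat_adjoint (mat_adjoint A) = (A :: complex mat)"
  by (rule eq_matI) auto

lemma mat_adjoint_mult:
  fixes A B :: "complex mat"
  assumes A: "A \<in> carrier_mat n m" and B: "B \<in> carrier_mat m k"
  shows "mat_adjoint (A * B) = mat_adjoint B * mat_adjoint A"
proof (rule eq_matI)
  fix i j assume "i < dim_row (mat_adjoint B * mat_adjoint A)" "j < dim_col (mat_adjoint B * mat_adjoint A)"
  then have ij: "i < k" "j < n" using A B by auto
  have "mat_adjoint (A * B) $$ (i, j) = cnj ((A * B) $$ (j, i))"
    using A B ij by (intro index_mat_adjoint) auto
  also have "\<dots> = (\<Sum>l<m. cnj (A $$ (j, l)) * cnj (B $$ (l, i)))"
    by (simp only: index_mult_mat_sum[OF A B ij(2,1)] cnj_sum complex_cnj_mult)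
  also have "\<dots> = (\<Sum>l<m. mat_adjoint B $$ (i, l) * mat_adjoint A $$ (l, j))"
    using A B ij by (intro sum.cong) (auto simp: mult.commute)
  also have "\<dots> = (mat_adjoint B * mat_adjoint A) $$ (i, j)"
    using index_mult_mat_sum[OF mat_adjoint_carrier[OF B] mat_adjoint_carrier[OF A] ij] by simp
  finally show "mat_adjoint (A * B) $$ (i, j) = (mat_adjoint B * mat_adjoint A) $$ (i, j)" .
qed (use A B in auto)

lemma mat_adjoint_smult:
  "mat_adjoint (a \<cdot>\<^sub>m A) = cnj a \<cdot>\<^sub>m mat_adjoint (A :: complex mat)"
  by (rule eq_matI) auto

lemma mat_adjoint_one [simp]: "mat_adjoint (1\<^sub>m n :: complex mat) = 1\<^sub>m n"
  by (rule eq_matI) auto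

definition mat_trace :: "complex mat \<Rightarrow> complex" where
  "mat_trace A = (\<Sum>i<dim_row A. A $$ (i, i))"

lemma mat_trace_mult_comm:
  assumes "A \<in> carrier_mat n m" "B \<in> carrier_mat m n"
  shows "mat_trace (A * B) = mat_trace (B * A)"
proof -
  have "mat_trace (A * B) = (\<Sum>i<n. \<Sum>l<m. A $$ (i, l) * B $$ (l, i))"
    unfolding mat_trace_def using assms
    by (auto intro!: sum.cong simp: scalar_prod_def atLeast0LessThan)
  also have "\<dots> = (\<Sum>l<m. \<Sum>i<n. B $$ (l, i) * A $$ (i, l))"
    by (subst sum.swap) (simp add: mult.commute)
  also have "\<dots> = mat_trace (B * A)"
    unfolding mat_trace_def using assms
    by (auto intro!: sum.cong simp: scalar_prod_def atLeast0LessThan)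
  finally show ?thesis .
qed

lemma mat_trace_smult_one [simp]: "mat_trace (a \<cdot>\<^sub>m 1\<^sub>m n) = a * of_nat n"
  by (simp add: mat_trace_def mult.commute)

lemma mat_trace_one [simp]: "mat_trace (1\<^sub>m n) = of_nat n"
  by (simp add: mat_trace_def)

lemma mat_trace_add:
  "A \<in> carrier_mat n n \<Longrightarrow> B \<in> carrier_mat n n \<Longrightarrow> mat_trace (A + B) = mat_trace A + mat_trace B"
  by (auto simp: mat_trace_def sum.distrib)

lemma mat_trace_minus:
  "A \<in> carrier_mat n n \<Longrightarrow> B \<in> carrier_mat n n \<Longrightarrow> mat_trace (A - B) = mat_trace A - mat_trace B"
  by (auto simp: mat_trace_def sum_subtractf)

text \<open>This is the squared Frobenius norm. That it vanishes only for \<open>A = 0\<close> later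
  lets nonzero intertwiners be cancelled; that it is never negative bounds the number of columns of
  an isometry.\<close>

lemma mat_trace_adjoint_mult_self:
  fixes A :: "complex mat"
  assumes A: "A \<in> carrier_mat n m"
  shows "mat_trace (mat_adjoint A * A) = of_real (\<Sum>j<m. \<Sum>i<n. (cmod (A $$ (i, j)))\<^sup>2)"
proof -
  have "(mat_adjoint A * A) $$ (j, j) = of_real (\<Sum>i<n. (cmod (A $$ (i, j)))\<^sup>2)" if j: "j < m" for j
  proof -
    have "(mat_adjoint A * A) $$ (j, j) = (\<Sum>i<n. mat_adjoint A $$ (j, i) * A $$ (i, j))"
      by (rule index_mult_mat_sum[OF mat_adjoint_carrier[OF A] A j j])
    also have "\<dots> = (\<Sum>i<n. of_real ((cmod (A $$ (i, j)))\<^sup>2))"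
    proof (rule sum.cong[OF refl])
      fix i assume "i \<in> {..<n}"
      then have "mat_adjoint A $$ (j, i) = cnj (A $$ (i, j))" using A j by simp
      then show "mat_adjoint A $$ (j, i) * A $$ (i, j) = of_real ((cmod (A $$ (i, j)))\<^sup>2)"
        by (simp only: complex_norm_square mult.commute)
    qed
    finally show ?thesis by simp
  qed
  then show ?thesis using A by (simp add: mat_trace_def)
qed

lemma adjoint_mult_self_eq_0_imp:
  fixes A :: "complex mat"
  assumes A: "A \<in> carrier_mat n m" and "mat_adjoint A * A = 0\<^sub>m m m"
  shows "A = 0\<^sub>m n m"
proof -
  have "complex_of_real (\<Sum>j<m. \<Sum>i<n. (cmod (A $$ (i, j)))\<^sup>2) = 0"
    using mat_trace_adjoint_mult_self[OF A] assms(2) by (simp add: mat_trace_def)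
  then have *: "(\<Sum>j<m. \<Sum>i<n. (cmod (A $$ (i, j)))\<^sup>2) = 0" by (simp only: of_real_eq_0_iff)
  have "A $$ (i, j) = 0" if "i < n" "j < m" for i j
  proof -
    from * have "\<forall>j\<in>{..<m}. (\<Sum>i<n. (cmod (A $$ (i, j)))\<^sup>2) = 0"
      by (subst (asm) sum_nonneg_eq_0_iff) (auto intro: sum_nonneg)
    then have "(\<Sum>i<n. (cmod (A $$ (i, j)))\<^sup>2) = 0" using that by simp
    then have "\<forall>i\<in>{..<n}. (cmod (A $$ (i, j)))\<^sup>2 = 0"
      by (subst (asm) sum_nonneg_eq_0_iff) auto
    then show ?thesis using that by simp
  qed
  then show ?thesis by (intro eq_matI) (simp_all add: carrier_matD[OF A])
qed

lemma isometry_trace: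
  fixes J :: "complex mat"
  assumes J: "J \<in> carrier_mat n m" and "mat_adjoint J * J = 1\<^sub>m m"
  shows "mat_trace (J * mat_adjoint J) = of_nat m"
  using mat_trace_mult_comm[OF J mat_adjoint_carrier[OF J]] assms(2) by simp

text \<open>The complementary projection \<open>R\<close> is self-adjoint and idempotent, so its
  trace \<open>n - m\<close> is its own squared Frobenius norm. The bound guarantees that an
  isometry with the most columns exists.\<close>

lemma isometry_dim_le:
  fixes J :: "complex mat"
  assumes J: "J \<in> carrier_mat n m" and iso: "mat_adjoint J * J = 1\<^sub>m m"
  shows "m \<le> n"
proof -
  define P where "P = J * mat_adjoint J"
  define R where "R = 1\<^sub>m n - P"
  have JA: "mat_adjoint J \<in> carrier_mat m n" using J by simp
  have P: "P \<in> carrier_mat n n" and R: "R \<in> carrier_mat n n" using J JA unfolding P_def R_def by (auto intro!: minus_carrier_mat)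
  have PP: "P * P = P"
  proof -
    have "P * P = J * (mat_adjoint J * J) * mat_adjoint J"
      using J JA unfolding P_def by (auto simp: mult_mat_assoc_dim)
    then show ?thesis using J iso by (simp add: P_def)
  qed
  have "mat_adjoint R = R"
  proof -
    have "mat_adjoint P = P" unfolding P_def using mat_adjoint_mult[OF J JA] by simp
    then have "cnj (P $$ (j, i)) = P $$ (i, j)" if "i < n" "j < n" for i j
      using index_mat_adjoint[of i P j] P that by simp
    then show ?thesis using mat_adjoint_carrier[OF R] P R
      by (intro eq_matI) (auto simp: R_def)
  qed
  then have "mat_adjoint R * R = R * R" by simp
  also have "\<dots> = R"
  proof -
    have "R * R = (1\<^sub>m n * R) - P * R"
      unfolding R_def using P by (intro minus_mult_distrib_mat[of _ n n]) (auto intro: minus_carrier_mat)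
    also have "P * R = P * 1\<^sub>m n - P * P" 
      unfolding R_def using P by (intro mult_minus_distrib_mat[of _ n n]) (auto intro: minus_carrier_mat)
    also have "\<dots> = 0\<^sub>m n n" using P PP by simp
    finally show ?thesis using R by (auto intro: eq_matI)
  qed
  finally have "mat_trace R = of_real (\<Sum>j<n. \<Sum>i<n. (cmod (R $$ (i, j)))\<^sup>2)"
    using mat_trace_adjoint_mult_self[OF R] by simp
  moreover have "mat_trace R = of_real (real n - real m)"
    using isometry_trace[OF J iso] mat_trace_minus[OF one_carrier_mat P] by (simp add: R_def P_def)
  ultimately have "real n - real m = (\<Sum>j<n. \<Sum>i<n. (cmod (R $$ (i, j)))\<^sup>2)"
    by (simp only: of_real_eq_iff)
  moreover have "\<dots> \<ge> 0" by (intro sum_nonneg) auto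
  ultimately show ?thesis by simp
qed

subsection \<open>Orthonormal bases of subspaces\<close>

lemma vec_subspace_iff:
  "VectorSpace.subspace class_ring W (module_vec TYPE(complex) n) \<longleftrightarrow>
     W \<subseteq> carrier_vec n \<and> 0\<^sub>v n \<in> W \<and> (\<forall>v\<in>W. \<forall>w\<in>W. v + w \<in> W) \<and> (\<forall>a. \<forall>v\<in>W. a \<cdot>\<^sub>v v \<in> W)"
proof
  assume "VectorSpace.subspace class_ring W (module_vec TYPE(complex) n)"
  then have "LinearCombinations.submodule class_ring W (module_vec TYPE(complex) n)"
    by (simp add: VectorSpace.subspace_def)
  then show "W \<subseteq> carrier_vec n \<and> 0\<^sub>v n \<in> W \<and> (\<forall>v\<in>W. \<forall>w\<in>W. v + w \<in> W) \<and>
      (\<forall>a. \<forall>v\<in>W. a \<cdot>\<^sub>v v \<in> W)"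
    by (auto simp: LinearCombinations.submodule_def module_vec_simps)
next
  assume "W \<subseteq> carrier_vec n \<and> 0\<^sub>v n \<in> W \<and> (\<forall>v\<in>W. \<forall>w\<in>W. v + w \<in> W) \<and>
    (\<forall>a. \<forall>v\<in>W. a \<cdot>\<^sub>v v \<in> W)"
  then show "VectorSpace.subspace class_ring W (module_vec TYPE(complex) n)"
    using vec_vs[where ?'a = complex, of n]
    by (auto simp: VectorSpace.subspace_def LinearCombinations.submodule_def module_vec_simps vectorspace_def)
qed

lemma zero_mat_mult_vec: "v \<in> carrier_vec m \<Longrightarrow> 0\<^sub>m n m *\<^sub>v v = 0\<^sub>v n"
  by (intro eq_vecI) auto

text \<open>
  Take an isometry \<open>J\<close> into \<open>W\<close> with the most columns: if \<open>J J\<^sup>\<dagger> w \<noteq> w\<close> for some \<open>w\<close> in \<open>W\<close>, then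
  normalising \<open>w - J J\<^sup>\<dagger> w\<close> yields a further column.
\<close>

lemma orthonormal_basis_exists:
  assumes W: "VectorSpace.subspace class_ring W (module_vec TYPE(complex) n)"
  obtains J m where "J \<in> carrier_mat n m" "mat_adjoint J * J = 1\<^sub>m m"
    "\<And>x. x \<in> carrier_vec m \<Longrightarrow> J *\<^sub>v x \<in> W"
    "\<And>w. w \<in> W \<Longrightarrow> J *\<^sub>v (mat_adjoint J *\<^sub>v w) = w"
proof -
  have sub: "W \<subseteq> carrier_vec n" and zero: "0\<^sub>v n \<in> W"
    and add: "\<And>v w. v \<in> W \<Longrightarrow> w \<in> W \<Longrightarrow> v + w \<in> W"
    and smult: "\<And>a v. v \<in> W \<Longrightarrow> a \<cdot>\<^sub>v v \<in> W"
    using W unfolding vec_subspace_iff by blast+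
  define isoW where "isoW m J \<longleftrightarrow> J \<in> carrier_mat n m \<and> mat_adjoint J * J = 1\<^sub>m m \<and>
    (\<forall>x\<in>carrier_vec m. J *\<^sub>v x \<in> W)" for m J
  \<comment> \<open>The matrix without columns qualifies, so there is some size to maximise
    over.\<close>
  have "isoW 0 (0\<^sub>m n 0)"
  proof -
    have "0\<^sub>m n 0 *\<^sub>v x = 0\<^sub>v n" if "x \<in> carrier_vec 0" for x :: "complex vec"
      using that by (intro eq_vecI) (auto simp: scalar_prod_def)
    then show ?thesis unfolding isoW_def using zero by (auto intro!: eq_matI)
  qed
  moreover have "m \<le> n" if "\<exists>J. isoW m J" for m
    using that isometry_dim_le unfolding isoW_def by blast
  ultimately obtain m where m: "\<exists>J. isoW m J" and max: "\<And>k. \<exists>J. isoW k J \<Longrightarrow> k \<le> m"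
    using Nat.ex_has_greatest_nat[of "\<lambda>m. \<exists>J. isoW m J" 0 n] by blast
  then obtain J where J: "J \<in> carrier_mat n m" and iso: "mat_adjoint J * J = 1\<^sub>m m"
    and JW: "\<And>x. x \<in> carrier_vec m \<Longrightarrow> J *\<^sub>v x \<in> W"
    unfolding isoW_def by blast
  have JA: "mat_adjoint J \<in> carrier_mat m n" using J by simp
  have "J *\<^sub>v (mat_adjoint J *\<^sub>v w) = w" if w: "w \<in> W" for w
  proof (rule ccontr)
    assume neq: "J *\<^sub>v (mat_adjoint J *\<^sub>v w) \<noteq> w"
    have wc: "w \<in> carrier_vec n" using w sub by auto
    define y where "y = mat_adjoint J *\<^sub>v w"
    have yc: "y \<in> carrier_vec m" unfolding y_def using JA wc by simp
    have Jyc: "J *\<^sub>v y \<in> carrier_vec n" using J yc by simp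
    define v where "v = w - J *\<^sub>v y"
    have vc: "v \<in> carrier_vec n" using wc Jyc by (simp add: v_def)
    have "v = w + (-1) \<cdot>\<^sub>v (J *\<^sub>v y)" unfolding v_def using wc J by (intro eq_vecI) auto
    then have vW: "v \<in> W" using add[OF w smult[OF JW[OF yc]]] by simp
    have "mat_adjoint J *\<^sub>v v = y - mat_adjoint J *\<^sub>v (J *\<^sub>v y)"
      unfolding v_def y_def using JA Jyc wc y_def by (simp add: mult_minus_distrib_mat_vec)
    also have "mat_adjoint J *\<^sub>v (J *\<^sub>v y) = y"
      using iso assoc_mult_mat_vec[OF JA J yc] yc by simp
    finally have Jv: "mat_adjoint J *\<^sub>v v = 0\<^sub>v m" using yc by simp
    have "v \<noteq> 0\<^sub>v n"
    proof
      assume "v = 0\<^sub>v n"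
      have "w $ i = (J *\<^sub>v y) $ i" if "i < n" for i
      proof -
        have "v $ i = w $ i - (J *\<^sub>v y) $ i" unfolding v_def using wc J that by auto
        then show ?thesis using \<open>v = 0\<^sub>v n\<close> that by simp
      qed
      then have "J *\<^sub>v y = w" using wc J by (intro eq_vecI) auto
      then show False using neq by (simp add: y_def)
    qed
    define r where "r = (\<Sum>i<n. (cmod (v $ i))\<^sup>2)"
    have "r > 0"
    proof -
      obtain i where "i < n" "v $ i \<noteq> 0" using \<open>v \<noteq> 0\<^sub>v n\<close> vc by (metis eq_vecI index_zero_vec carrier_vecD)
      then show ?thesis unfolding r_def by (intro sum_pos2[of _ i]) auto
    qed
    define s where "s = complex_of_real (sqrt r)"
    have s0: "s \<noteq> 0" using \<open>r > 0\<close> by (simp add: s_def)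
    have ss: "cnj s * s = of_real r"
      using \<open>r > 0\<close> by (simp add: s_def flip: of_real_mult)
    define J' where "J' = mat n (Suc m) (\<lambda>(i, j). if j < m then J $$ (i, j) else v $ i / s)"
    have J': "J' \<in> carrier_mat n (Suc m)" by (simp add: J'_def)
    have vJ: "(\<Sum>l<n. cnj (J $$ (l, i)) * v $ l) = 0" if "i < m" for i
    proof -
      have "(mat_adjoint J *\<^sub>v v) $ i = (\<Sum>l<n. mat_adjoint J $$ (i, l) * v $ l)"
        by (rule index_mult_mat_vec_sum[OF JA vc that])
      also have "\<dots> = (\<Sum>l<n. cnj (J $$ (l, i)) * v $ l)" using J that by (intro sum.cong) auto
      finally show ?thesis using Jv that by simp
    qed
    have JJ: "(\<Sum>l<n. cnj (J $$ (l, i)) * J $$ (l, j)) = (if i = j then 1 else 0)" if "i < m" "j < m" for i j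
    proof -
      have "(mat_adjoint J * J) $$ (i, j) = (\<Sum>l<n. mat_adjoint J $$ (i, l) * J $$ (l, j))"
        by (rule index_mult_mat_sum[OF JA J that])
      also have "\<dots> = (\<Sum>l<n. cnj (J $$ (l, i)) * J $$ (l, j))" using J that by (intro sum.cong) auto
      finally show ?thesis using iso that by simp
    qed
    have "mat_adjoint J' * J' = 1\<^sub>m (Suc m)"
    proof (rule eq_matI)
      fix i j assume "i < dim_row (1\<^sub>m (Suc m) :: complex mat)" "j < dim_col (1\<^sub>m (Suc m) :: complex mat)"
      then have i: "i < Suc m" and j: "j < Suc m" by auto
      have "(mat_adjoint J' * J') $$ (i, j) = (\<Sum>l<n. mat_adjoint J' $$ (i, l) * J' $$ (l, j))"
        by (rule index_mult_mat_sum[OF mat_adjoint_carrier[OF J'] J' i j])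
      also have "\<dots> = (\<Sum>l<n. cnj (J' $$ (l, i)) * J' $$ (l, j))"
        using J' i j by (intro sum.cong) auto
      \<comment> \<open>Column \<open>m\<close> is the new one. The Gram matrix is the old one in
        the main block, zero in the mixed blocks because \<open>v\<close> is orthogonal to the
        columns of \<open>J\<close>, and \<open>r / (cnj s * s) = 1\<close> in the corner.\<close>
      also have "\<dots> = (if i = j then 1 else 0)"
      proof (cases "i < m")
        case True
        show ?thesis
        proof (cases "j < m")
          case jm: True
          then show ?thesis using JJ[OF True jm] i j True by (simp add: J'_def)
        next
          case False
          have "(\<Sum>l<n. cnj (J' $$ (l, i)) * J' $$ (l, j)) = (\<Sum>l<n. cnj (J $$ (l, i)) * v $ l) / s"
            using True False i j by (simp add: J'_def sum_divide_distrib)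
          then show ?thesis using vJ[OF True] True False by auto
        qed
      next
        case False
        then have im: "i = m" using i by simp
        show ?thesis
        proof (cases "j < m")
          case jm: True
          have "(\<Sum>l<n. cnj (J' $$ (l, i)) * J' $$ (l, j)) = cnj ((\<Sum>l<n. cnj (J $$ (l, j)) * v $ l) / s)"
            using jm im j by (simp add: J'_def sum_divide_distrib mult.commute)
          then show ?thesis using vJ[OF jm] jm im by auto
        next
          case jm: False
          then have "j = m" using j by simp
          then have "(\<Sum>l<n. cnj (J' $$ (l, i)) * J' $$ (l, j)) = (\<Sum>l<n. v $ l * cnj (v $ l)) / (cnj s * s)"
            using im by (simp add: J'_def sum_divide_distrib mult.commute)
          also have "(\<Sum>l<n. v $ l * cnj (v $ l)) = of_real r"
            by (simp add: r_def complex_norm_square del: of_real_power)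
          finally show ?thesis using ss \<open>r > 0\<close> im \<open>j = m\<close> by simp
        qed
      qed
      finally show "(mat_adjoint J' * J') $$ (i, j) = 1\<^sub>m (Suc m) $$ (i, j)" using i j by simp
    qed (use J' in auto)
    moreover have "J' *\<^sub>v x \<in> W" if x: "x \<in> carrier_vec (Suc m)" for x
    proof -
      define x' where "x' = vec m (($) x)"
      have x'c: "x' \<in> carrier_vec m" by (simp add: x'_def)
      have "J' *\<^sub>v x = J *\<^sub>v x' + (x $ m / s) \<cdot>\<^sub>v v"
      proof (rule eq_vecI)
        fix i assume "i < dim_vec (J *\<^sub>v x' + (x $ m / s) \<cdot>\<^sub>v v)"
        then have i: "i < n" using vc by simp
        have "(J' *\<^sub>v x) $ i = (\<Sum>l<m. J $$ (i, l) * x $ l) + x $ m / s * v $ i"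
          unfolding index_mult_mat_vec_sum[OF J' x i] using i by (simp add: J'_def)
        also have "(\<Sum>l<m. J $$ (i, l) * x $ l) = (J *\<^sub>v x') $ i"
          unfolding index_mult_mat_vec_sum[OF J x'c i] by (simp add: x'_def)
        finally show "(J' *\<^sub>v x) $ i = (J *\<^sub>v x' + (x $ m / s) \<cdot>\<^sub>v v) $ i"
          using i J vc by simp
      qed (use J J' vc in auto)
      then show ?thesis using add[OF JW[OF x'c] smult[OF vW]] by simp
    qed
    ultimately have "isoW (Suc m) J'" unfolding isoW_def using J' by blast
    then show False using max[of "Suc m"] by auto
  qed
  then show thesis using that J iso JW by blast
qed

lemma kernel_subspace:
  assumes "A \<in> carrier_mat m n"
  shows "VectorSpace.subspace class_ring {v \<in> carrier_vec n. A *\<^sub>v v = 0\<^sub>v m} (module_vec TYPE(complex) n)"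
  unfolding vec_subspace_iff using assms by (auto simp: mult_add_distrib_mat_vec[of _ m n] mult_mat_vec[of _ m n])

lemma eigenspace_subspace:
  assumes "A \<in> carrier_mat n n"
  shows "VectorSpace.subspace class_ring {v \<in> carrier_vec n. A *\<^sub>v v = a \<cdot>\<^sub>v v} (module_vec TYPE(complex) n)"
  unfolding vec_subspace_iff using assms
  by (auto simp: mult_add_distrib_mat_vec[of _ n n] mult_mat_vec[of _ n n] smult_add_distrib_vec[of _ n]
      smult_smult_assoc mult.commute)

text \<open>\<open>K\<close> is an orthonormal basis of the kernel of
  \<open>J\<^sup>\<dagger>\<close>, the orthogonal complement of \<open>W\<close>. Properness of
  \<open>W\<close> on both sides makes \<open>m\<close> and \<open>k\<close> strictly smaller than
  \<open>n\<close>, which is what an induction on the dimension needs.\<close>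

lemma orthogonal_splitting:
  assumes W: "VectorSpace.subspace class_ring W (module_vec TYPE(complex) n)"
    and W0: "W \<noteq> {0\<^sub>v n}" and Wn: "W \<noteq> carrier_vec n"
  obtains J K m k where
    "J \<in> carrier_mat n m" "mat_adjoint J * J = 1\<^sub>m m" "m < n"
    "\<And>x. x \<in> carrier_vec m \<Longrightarrow> J *\<^sub>v x \<in> W"
    "\<And>w. w \<in> W \<Longrightarrow> J *\<^sub>v (mat_adjoint J *\<^sub>v w) = w"
    "K \<in> carrier_mat n k" "mat_adjoint K * K = 1\<^sub>m k" "k < n"
    "\<And>v. v \<in> carrier_vec n \<Longrightarrow> mat_adjoint J *\<^sub>v v = 0\<^sub>v m \<Longrightarrow> K *\<^sub>v (mat_adjoint K *\<^sub>v v) = v"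
    "mat_adjoint J * K = 0\<^sub>m m k"
    "J * mat_adjoint J + K * mat_adjoint K = 1\<^sub>m n"
proof -
  have sub: "W \<subseteq> carrier_vec n" and zero: "0\<^sub>v n \<in> W"
    using W unfolding vec_subspace_iff by auto
  obtain J m where J: "J \<in> carrier_mat n m" and Ji: "mat_adjoint J * J = 1\<^sub>m m"
    and JW: "\<And>x. x \<in> carrier_vec m \<Longrightarrow> J *\<^sub>v x \<in> W"
    and WJ: "\<And>w. w \<in> W \<Longrightarrow> J *\<^sub>v (mat_adjoint J *\<^sub>v w) = w"
    by (rule orthonormal_basis_exists[OF W]) (rule that; blast)
  have JA: "mat_adjoint J \<in> carrier_mat m n" using J by simp
  obtain K k where K: "K \<in> carrier_mat n k" and Ki: "mat_adjoint K * K = 1\<^sub>m k"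
    and KW: "\<And>x. x \<in> carrier_vec k \<Longrightarrow> K *\<^sub>v x \<in> {v \<in> carrier_vec n. mat_adjoint J *\<^sub>v v = 0\<^sub>v m}"
    and WK: "\<And>w. w \<in> {v \<in> carrier_vec n. mat_adjoint J *\<^sub>v v = 0\<^sub>v m} \<Longrightarrow> K *\<^sub>v (mat_adjoint K *\<^sub>v w) = w"
    by (rule orthonormal_basis_exists[OF kernel_subspace[OF JA]]) (rule that; blast)
  have KA: "mat_adjoint K \<in> carrier_mat k n" using K by simp
  have JK: "mat_adjoint J * K = 0\<^sub>m m k"
  proof (rule eq_mat_if_eq_mult_vec[of _ m k])
    fix v :: "complex vec" assume v: "v \<in> carrier_vec k"
    show "mat_adjoint J * K *\<^sub>v v = 0\<^sub>m m k *\<^sub>v v"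
      using KW[OF v] v assoc_mult_mat_vec[OF JA K v] by (auto intro!: eq_vecI)
  qed (use JA K in auto)
  have KJ: "mat_adjoint K * J = 0\<^sub>m k m"
    using arg_cong[OF JK, of mat_adjoint] mat_adjoint_mult[OF JA K]
    by (auto intro!: eq_matI)
  have PJ: "J * mat_adjoint J \<in> carrier_mat n n" and PK: "K * mat_adjoint K \<in> carrier_mat n n"
    using J JA K KA by auto
  \<comment> \<open>Split \<open>v\<close> as \<open>J y + u\<close>. Then \<open>u\<close> lies in
    the kernel of \<open>J\<^sup>\<dagger>\<close>, so \<open>K K\<^sup>\<dagger>\<close> fixes it,
    while \<open>K\<^sup>\<dagger> J = 0\<close> makes \<open>u\<close> and \<open>v\<close> have
    the same image under \<open>K\<^sup>\<dagger>\<close>.\<close>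
  have total: "J * mat_adjoint J + K * mat_adjoint K = 1\<^sub>m n"
  proof (rule eq_mat_if_eq_mult_vec[of _ n n])
    fix v :: "complex vec" assume v: "v \<in> carrier_vec n"
    define y where "y = mat_adjoint J *\<^sub>v v"
    have y: "y \<in> carrier_vec m" using JA v by (simp add: y_def)
    have Jy: "J *\<^sub>v y \<in> carrier_vec n" using J y by simp
    define u where "u = v - J *\<^sub>v y"
    have u: "u \<in> carrier_vec n" using v Jy by (simp add: u_def)
    have Ju: "mat_adjoint J *\<^sub>v u = 0\<^sub>v m"
    proof -
      have "mat_adjoint J *\<^sub>v u = y - mat_adjoint J *\<^sub>v (J *\<^sub>v y)"
        unfolding u_def using mult_minus_distrib_mat_vec[OF JA v Jy] by (simp add: y_def)
      also have "mat_adjoint J *\<^sub>v (J *\<^sub>v y) = y"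
        using Ji assoc_mult_mat_vec[OF JA J y] y by simp
      finally show ?thesis using y by simp
    qed
    have "mat_adjoint K *\<^sub>v u = mat_adjoint K *\<^sub>v v - mat_adjoint K *\<^sub>v (J *\<^sub>v y)"
      unfolding u_def using mult_minus_distrib_mat_vec[OF KA v Jy] .
    also have "mat_adjoint K *\<^sub>v (J *\<^sub>v y) = 0\<^sub>v k"
      using KJ assoc_mult_mat_vec[OF KA J y] zero_mat_mult_vec[OF y] by simp
    finally have Ku: "mat_adjoint K *\<^sub>v u = mat_adjoint K *\<^sub>v v" using KA v by simp
    have "K *\<^sub>v (mat_adjoint K *\<^sub>v v) = u" using WK[of u] u Ju Ku by simp
    then have "(J * mat_adjoint J + K * mat_adjoint K) *\<^sub>v v = J *\<^sub>v y + u"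
      using add_mult_distrib_mat_vec[OF PJ PK v] assoc_mult_mat_vec[OF J JA v]
        assoc_mult_mat_vec[OF K KA v] by (simp add: y_def)
    also have "\<dots> = v" unfolding u_def using v J by (intro eq_vecI) auto
    finally show "(J * mat_adjoint J + K * mat_adjoint K) *\<^sub>v v = 1\<^sub>m n *\<^sub>v v" using v by simp
  qed (use PJ PK in auto)
  \<comment> \<open>The traces of the two projections are \<open>m\<close> and \<open>k\<close>, and
    they add up to the trace of the identity.\<close>
  have "of_nat (m + k) = (of_nat n :: complex)"
    using arg_cong[OF total, of mat_trace] mat_trace_add[OF PJ PK] isometry_trace[OF J Ji]
      isometry_trace[OF K Ki] by simp
  then have dim: "m + k = n" by (simp only: of_nat_eq_iff)
  have "m \<noteq> 0"
  proof
    assume "m = 0"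
    have "w = 0\<^sub>v n" if "w \<in> W" for w
    proof -
      have "J = 0\<^sub>m n m" using J \<open>m = 0\<close> by (intro eq_matI) auto
      moreover have "mat_adjoint J *\<^sub>v w \<in> carrier_vec m"
        using JA sub that by (auto intro: mult_mat_vec_carrier)
      ultimately show ?thesis using WJ[OF that] zero_mat_mult_vec[of _ m n] by metis
    qed
    then have "W = {0\<^sub>v n}" using zero by blast
    then show False using W0 by blast
  qed
  moreover have "k \<noteq> 0"
  proof
    assume "k = 0"
    have "v \<in> W" if v: "v \<in> carrier_vec n" for v
    proof -
      have "K * mat_adjoint K = 0\<^sub>m n n" using K \<open>k = 0\<close> by (intro eq_matI) (auto simp: scalar_prod_def)
      then have "J * mat_adjoint J = 1\<^sub>m n" using total PJ by simp
      then have "J *\<^sub>v (mat_adjoint J *\<^sub>v v) = v" using assoc_mult_mat_vec[OF J JA v] v by simp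
      then show ?thesis using JW[of "mat_adjoint J *\<^sub>v v"] JA v by simp
    qed
    then show False using Wn sub by blast
  qed
  ultimately show thesis
    using WK dim by (intro that[OF J Ji _ JW WJ K Ki _ _ JK total]) simp_all
qed

subsection \<open>Kronecker products\<close>

text \<open>The index \<open>i * m + j\<close> encodes the pair \<open>(i, j)\<close> of tensor
  factors.\<close>

lemma sum_lessThan_mult:
  fixes h :: "nat \<Rightarrow> 'b::comm_monoid_add"
  shows "(\<Sum>l<n * m. h l) = (\<Sum>i<n. \<Sum>j<m. h (i * m + j))"
proof -
  have "(\<Sum>l\<in>{i * m..<i * m + m}. h l) = (\<Sum>j<m. h (i * m + j))" for i
    using sum.shift_bounds_nat_ivl[of h 0 "i * m" m] by (simp add: atLeast0LessThan add.commute)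
  then show ?thesis by (simp flip: sum.nat_group)
qed

lemma kronecker_carrier [simp]:
  "A \<in> carrier_mat n n' \<Longrightarrow> B \<in> carrier_mat m m' \<Longrightarrow> kronecker A B \<in> carrier_mat (n * m) (n' * m')"
  unfolding kronecker_def by (intro carrier_matI) (auto dest: carrier_matD)

lemma index_kronecker:
  assumes "A \<in> carrier_mat n n'" "B \<in> carrier_mat m m'" "i < n * m" "j < n' * m'"
  shows "kronecker A B $$ (i, j) = A $$ (i div m, j div m') * B $$ (i mod m, j mod m')"
  using assms carrier_matD[OF assms(1)] carrier_matD[OF assms(2)] unfolding kronecker_def by simp

lemma div_mod_less:
  fixes i n m :: nat
  assumes "i < n * m"
  shows "i div m < n" "i mod m < m"
  using assms by (auto simp: less_mult_imp_div_less intro!: mod_less_divisor gr0I)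

lemma kronecker_mult:
  assumes A: "A \<in> carrier_mat n p" and B: "B \<in> carrier_mat m q"
    and C: "C \<in> carrier_mat p n'" and D: "D \<in> carrier_mat q m'"
  shows "kronecker A B * kronecker C D = kronecker (A * C) (B * D)"
proof (rule eq_matI)
  note AB = kronecker_carrier[OF A B] and CD = kronecker_carrier[OF C D]
  note AC = mult_carrier_mat[OF A C] and BD = mult_carrier_mat[OF B D]
  note dims = carrier_matD[OF kronecker_carrier[OF AC BD]]
  show "dim_row (kronecker A B * kronecker C D) = dim_row (kronecker (A * C) (B * D))"
    "dim_col (kronecker A B * kronecker C D) = dim_col (kronecker (A * C) (B * D))"
    using dims carrier_matD[OF AB] carrier_matD[OF CD] by simp_all
  fix i j assume "i < dim_row (kronecker (A * C) (B * D))" "j < dim_col (kronecker (A * C) (B * D))"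
  then have ij: "i < n * m" "j < n' * m'" using dims by simp_all
  note im = div_mod_less[OF ij(1)] and jm = div_mod_less[OF ij(2)]
  have "(kronecker A B * kronecker C D) $$ (i, j)
      = (\<Sum>l<p * q. kronecker A B $$ (i, l) * kronecker C D $$ (l, j))"
    by (rule index_mult_mat_sum[OF AB CD ij])
  also have "\<dots> = (\<Sum>r<p. \<Sum>s<q. (A $$ (i div m, r) * C $$ (r, j div m')) * (B $$ (i mod m, s) * D $$ (s, j mod m')))"
    unfolding sum_lessThan_mult
  proof (intro sum.cong refl)
    fix r s assume "r \<in> {..<p}" "s \<in> {..<q}"
    then have rs: "r < p" "s < q" by auto
    have "r * q + s < Suc r * q" using rs by simp
    also have "\<dots> \<le> p * q" using rs by (intro mult_le_mono1) simp
    finally have "r * q + s < p * q" .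
    then show "kronecker A B $$ (i, r * q + s) * kronecker C D $$ (r * q + s, j)
      = (A $$ (i div m, r) * C $$ (r, j div m')) * (B $$ (i mod m, s) * D $$ (s, j mod m'))"
      using rs index_kronecker[OF A B ij(1)] index_kronecker[OF C D _ ij(2)] by (simp add: mult_ac)
  qed
  also have "\<dots> = (A * C) $$ (i div m, j div m') * (B * D) $$ (i mod m, j mod m')"
    unfolding index_mult_mat_sum[OF A C im(1) jm(1)] index_mult_mat_sum[OF B D im(2) jm(2)] sum_product ..
  also have "\<dots> = kronecker (A * C) (B * D) $$ (i, j)"
    by (rule index_kronecker[OF AC BD ij, symmetric])
  finally show "(kronecker A B * kronecker C D) $$ (i, j) = kronecker (A * C) (B * D) $$ (i, j)" .
qed

lemma kronecker_one: "kronecker (1\<^sub>m n) (1\<^sub>m m) = 1\<^sub>m (n * m)"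
proof (rule eq_matI)
  fix i j assume "i < dim_row (1\<^sub>m (n * m) :: complex mat)" "j < dim_col (1\<^sub>m (n * m) :: complex mat)"
  then have ij: "i < n * m" "j < n * m" by auto
  have "i = j" if "i div m = j div m" "i mod m = j mod m" using that by (metis div_mult_mod_eq)
  then show "kronecker (1\<^sub>m n) (1\<^sub>m m) $$ (i, j) = 1\<^sub>m (n * m) $$ (i, j)"
    using ij div_mod_less[OF ij(1)] div_mod_less[OF ij(2)]
    by (auto simp: index_kronecker[OF one_carrier_mat one_carrier_mat ij])
qed (auto simp: kronecker_def)

lemma kronecker_smult: "kronecker (a \<cdot>\<^sub>m A) (b \<cdot>\<^sub>m B) = (a * b) \<cdot>\<^sub>m kronecker A B"
proof (rule eq_matI)
  fix i j assume "i < dim_row ((a * b) \<cdot>\<^sub>m kronecker A B)" "j < dim_col ((a * b) \<cdot>\<^sub>m kronecker A B)"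
  then have ij: "i < dim_row A * dim_row B" "j < dim_col A * dim_col B" by (auto simp: kronecker_def)
  show "kronecker (a \<cdot>\<^sub>m A) (b \<cdot>\<^sub>m B) $$ (i, j) = ((a * b) \<cdot>\<^sub>m kronecker A B) $$ (i, j)"
    using ij div_mod_less[OF ij(1)] div_mod_less[OF ij(2)] by (simp add: kronecker_def)
qed (auto simp: kronecker_def)

lemma mat_adjoint_kronecker: "mat_adjoint (kronecker A B) = kronecker (mat_adjoint A) (mat_adjoint B)"
proof (rule eq_matI)
  fix i j assume "i < dim_row (kronecker (mat_adjoint A) (mat_adjoint B))"
    "j < dim_col (kronecker (mat_adjoint A) (mat_adjoint B))"
  then have ij: "i < dim_col A * dim_col B" "j < dim_row A * dim_row B" by (auto simp: kronecker_def)
  show "mat_adjoint (kronecker A B) $$ (i, j) = kronecker (mat_adjoint A) (mat_adjoint B) $$ (i, j)"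
    using ij div_mod_less[OF ij(1)] div_mod_less[OF ij(2)] by (simp add: kronecker_def)
qed (auto simp: kronecker_def)

lemma unitary_mat_kronecker:
  assumes "unitary_mat n A" "unitary_mat m B"
  shows "unitary_mat (n * m) (kronecker A B)"
proof -
  have A: "A \<in> carrier_mat n n" and B: "B \<in> carrier_mat m m" using assms by (simp_all add: unitary_mat_def)
  note AA = mat_adjoint_carrier[OF A] and BA = mat_adjoint_carrier[OF B]
  show ?thesis
    using assms kronecker_carrier[OF A B]
    unfolding unitary_mat_def mat_adjoint_kronecker kronecker_mult[OF A B AA BA] kronecker_mult[OF AA BA A B]
    by (simp add: kronecker_one)
qed

subsection \<open>Combinations of the operators of a projective representation\<close>

locale finite_group = group +
  assumes finite_carrier: "finite (carrier G)"
begin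

lemma op_combination_carrier [simp]: "op_combination G n E c \<in> carrier_mat n n"
  by (simp add: op_combination_def)

lemma dim_op_combination [simp]:
  "dim_row (op_combination G n E c) = n" "dim_col (op_combination G n E c) = n"
  by (simp_all add: op_combination_def)

lemma index_op_combination:
  "i < n \<Longrightarrow> j < n \<Longrightarrow> op_combination G n E c $$ (i, j) = (\<Sum>f\<in>carrier G. c f * E f $$ (i, j))"
  by (simp add: op_combination_def)

lemma op_combination_cong:
  "(\<And>f. f \<in> carrier G \<Longrightarrow> c f = c' f) \<Longrightarrow> op_combination G n E c = op_combination G n E c'"
  by (simp add: op_combination_def cong: sum.cong)

lemma op_combination_diff:
  "op_combination G n E (\<lambda>f. c f - c' f) = op_combination G n E c - op_combination G n E c'"
  by (rule eq_matI) (auto simp: index_op_combination sum_subtractf left_diff_distrib)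

lemma op_combination_delta_one:
  assumes "E \<one> = 1\<^sub>m n"
  shows "op_combination G n E (\<lambda>g. if g = \<one> then 1 else 0) = 1\<^sub>m n"
proof -
  have "(\<Sum>f\<in>carrier G. (if f = \<one> then 1 else 0) * E f $$ (i, j)) = E \<one> $$ (i, j)" for i j
  proof -
    have "(\<Sum>f\<in>carrier G. (if f = \<one> then 1 else 0) * E f $$ (i, j))
        = (\<Sum>f\<in>carrier G. if f = \<one> then E f $$ (i, j) else 0)"
      by (intro sum.cong) auto
    then show ?thesis using finite_carrier by simp
  qed
  then show ?thesis using assms by (intro eq_matI) (auto simp: op_combination_def)
qed

lemma index_mult_op_combination:
  assumes X: "X \<in> carrier_mat m n" and E: "\<And>f. f \<in> carrier G \<Longrightarrow> E f \<in> carrier_mat n n"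
    and ij: "i < m" "j < n"
  shows "(X * op_combination G n E c) $$ (i, j) = (\<Sum>f\<in>carrier G. c f * (X * E f) $$ (i, j))"
proof -
  have "(X * op_combination G n E c) $$ (i, j) = (\<Sum>l<n. X $$ (i, l) * (\<Sum>f\<in>carrier G. c f * E f $$ (l, j)))"
    unfolding index_mult_mat_sum[OF X op_combination_carrier ij]
    using ij by (intro sum.cong) (auto simp: index_op_combination)
  also have "\<dots> = (\<Sum>f\<in>carrier G. c f * (\<Sum>l<n. X $$ (i, l) * E f $$ (l, j)))"
    unfolding sum_distrib_left by (subst sum.swap) (simp add: mult.left_commute)
  also have "\<dots> = (\<Sum>f\<in>carrier G. c f * (X * E f) $$ (i, j))"
    using index_mult_mat_sum[OF X E ij] by (intro sum.cong) auto
  finally show ?thesis .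
qed

lemma index_op_combination_mult:
  assumes X: "X \<in> carrier_mat n m" and E: "\<And>f. f \<in> carrier G \<Longrightarrow> E f \<in> carrier_mat n n"
    and ij: "i < n" "j < m"
  shows "(op_combination G n E c * X) $$ (i, j) = (\<Sum>f\<in>carrier G. c f * (E f * X) $$ (i, j))"
proof -
  have "(op_combination G n E c * X) $$ (i, j) = (\<Sum>l<n. (\<Sum>f\<in>carrier G. c f * E f $$ (i, l)) * X $$ (l, j))"
    unfolding index_mult_mat_sum[OF op_combination_carrier X ij]
    using ij by (intro sum.cong) (auto simp: index_op_combination)
  also have "\<dots> = (\<Sum>f\<in>carrier G. c f * (\<Sum>l<n. E f $$ (i, l) * X $$ (l, j)))"
    unfolding sum_distrib_left sum_distrib_right by (subst sum.swap) (simp add: mult.assoc)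
  also have "\<dots> = (\<Sum>f\<in>carrier G. c f * (E f * X) $$ (i, j))"
    using index_mult_mat_sum[OF E X ij] by (intro sum.cong) auto
  finally show ?thesis .
qed

text \<open>Linearity extends the intertwining relation from the single operators to all
  combinations. Every transfer of a vanishing statement between two representations goes through
  this.\<close>

lemma op_combination_intertwine:
  assumes J: "J \<in> carrier_mat n m"
    and E: "\<And>f. f \<in> carrier G \<Longrightarrow> E f \<in> carrier_mat n n"
    and E': "\<And>f. f \<in> carrier G \<Longrightarrow> E' f \<in> carrier_mat m m"
    and JE: "\<And>f. f \<in> carrier G \<Longrightarrow> J * E' f = E f * J"
  shows "J * op_combination G m E' c = op_combination G n E c * J"
proof (rule eq_matI)
  fix i j assume "i < dim_row (op_combination G n E c * J)" "j < dim_col (op_combination G n E c * J)"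
  then have ij: "i < n" "j < m" using J by auto
  show "(J * op_combination G m E' c) $$ (i, j) = (op_combination G n E c * J) $$ (i, j)"
  proof -
    have "(J * op_combination G m E' c) $$ (i, j) = (\<Sum>f\<in>carrier G. c f * (J * E' f) $$ (i, j))"
      by (rule index_mult_op_combination[OF J E' ij])
    also have "\<dots> = (\<Sum>f\<in>carrier G. c f * (E f * J) $$ (i, j))"
      by (intro sum.cong refl) (simp only: JE)
    also have "\<dots> = (op_combination G n E c * J) $$ (i, j)"
      by (rule index_op_combination_mult[OF J E ij, symmetric])
    finally show ?thesis .
  qed
qed (use J in auto)

lemma proj_unitary_repD:
  assumes "proj_unitary_rep G n \<gamma> E" "f \<in> carrier G"
  shows "E f \<in> carrier_mat n n" "dim_row (E f) = n" "dim_col (E f) = n"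
    "mat_adjoint (E f) * E f = 1\<^sub>m n" "E f * mat_adjoint (E f) = 1\<^sub>m n"
    "mat_adjoint (E f) \<in> carrier_mat n n"
    "g \<in> carrier G \<Longrightarrow> cmod (\<gamma> f g) = 1"
    "g \<in> carrier G \<Longrightarrow> E f * E g = \<gamma> f g \<cdot>\<^sub>m E (f \<otimes> g)"
  using assms unfolding proj_unitary_rep_def unitary_mat_def by (auto dest: carrier_matD)

lemma cnj_mult_self_cmod_1: "cmod a = 1 \<Longrightarrow> cnj a * a = 1"
  using complex_norm_square[of a] by (simp add: mult.commute)

text \<open>Multiply \<open>E(f) E(g) = \<gamma>(f,g) E(fg)\<close> by
  \<open>E(f)\<^sup>\<dagger>\<close> and invert the phase by conjugation. Using the adjoint instead
  of \<open>E\<close> at the inverse element keeps further phases out, and it explains the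
  conjugated \<open>\<gamma>\<close> in (iii).\<close>

lemma proj_unitary_rep_adjoint_mult:
  assumes E: "proj_unitary_rep G n \<gamma> E" and f: "f \<in> carrier G" and g: "g \<in> carrier G"
  shows "mat_adjoint (E f) * E (f \<otimes> g) = cnj (\<gamma> f g) \<cdot>\<^sub>m E g"
proof -
  note R = proj_unitary_repD[OF E]
  have fg: "f \<otimes> g \<in> carrier G" using f g by simp
  have "E (f \<otimes> g) = cnj (\<gamma> f g) \<cdot>\<^sub>m (E f * E g)"
    unfolding R(8)[OF f g] using cnj_mult_self_cmod_1[OF R(7)[OF f g]] R(2,3)[OF fg]
    by (intro eq_matI) (auto simp flip: mult.assoc)
  then have "mat_adjoint (E f) * E (f \<otimes> g) = cnj (\<gamma> f g) \<cdot>\<^sub>m (mat_adjoint (E f) * (E f * E g))"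
    using mult_smult_distrib[OF R(6)[OF f] mult_carrier_mat[OF R(1)[OF f] R(1)[OF g]]] by simp
  also have "mat_adjoint (E f) * (E f * E g) = E g"
    using assoc_mult_mat[OF R(6)[OF f] R(1)[OF f] R(1)[OF g]] R(1)[OF g] R(4)[OF f] by simp
  finally show ?thesis .
qed

text \<open>This is the function \<open>q\<close> of the overview, kept apart so that it can be fed
  to \<open>op_combination\<close> as a coefficient function.\<close>

definition correlation :: "('a \<Rightarrow> 'a \<Rightarrow> complex) \<Rightarrow> ('a \<Rightarrow> complex) \<Rightarrow> 'a \<Rightarrow> complex" where
  "correlation \<gamma> c g = (\<Sum>f\<in>carrier G. cnj (\<gamma> f g) * cnj (c f) * c (f \<otimes> g))"

lemma orthonormal_coeffs_iff:
  "orthonormal_coeffs G \<gamma> c \<longleftrightarrow> (\<forall>g\<in>carrier G. correlation \<gamma> c g = (if g = \<one> then 1 else 0))"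
  by (simp add: orthonormal_coeffs_def correlation_def)

lemma sum_translate:
  assumes "f \<in> carrier G"
  shows "(\<Sum>g\<in>carrier G. h (f \<otimes> g)) = (\<Sum>k\<in>carrier G. h k)"
  by (rule sum.reindex_bij_witness[of _ "\<lambda>k. inv f \<otimes> k" "\<lambda>g. f \<otimes> g"])
    (use assms in \<open>auto simp flip: m_assoc\<close>)

text \<open>Expand both factors and, for fixed \<open>f\<close>, write the second summation index as
  \<open>f \<otimes> g\<close>. Each product of operators is then a phase times \<open>E g\<close>,
  and collecting the coefficients of \<open>E g\<close> gives the correlation.\<close>

lemma adjoint_op_combination_mult_self:
  assumes E: "proj_unitary_rep G n \<gamma> E"
  shows "mat_adjoint (op_combination G n E c) * op_combination G n E c
           = op_combination G n E (correlation \<gamma> c)"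
proof (rule eq_matI)
  note R = proj_unitary_repD[OF E]
  let ?L = "op_combination G n E c"
  fix i j assume "i < dim_row (op_combination G n E (correlation \<gamma> c))"
    "j < dim_col (op_combination G n E (correlation \<gamma> c))"
  then have i: "i < n" and j: "j < n" by auto
  \<comment> \<open>Linearity is available for sums on the right of a product only up to adjoints,
    so the entry is read as the conjugate of the transposed entry of
    \<open>E(k)\<^sup>\<dagger> L\<close>.\<close>
  have *: "(mat_adjoint ?L * E k) $$ (i, j) = (\<Sum>f\<in>carrier G. cnj (c f) * (mat_adjoint (E f) * E k) $$ (i, j))"
    if k: "k \<in> carrier G" for k
  proof -
    have adj: "mat_adjoint (mat_adjoint (E k) * X) = mat_adjoint X * E k" if "X \<in> carrier_mat n n" for X
      using mat_adjoint_mult[OF R(6)[OF k] that] by simp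
    have swap: "cnj ((mat_adjoint (E k) * X) $$ (j, i)) = (mat_adjoint X * E k) $$ (i, j)"
      if X: "X \<in> carrier_mat n n" for X
    proof -
      have "mat_adjoint (E k) * X \<in> carrier_mat n n" using R(6)[OF k] X by simp
      note d = carrier_matD[OF this]
      show ?thesis unfolding adj[OF X, symmetric] using i j d
        by (subst index_mat_adjoint) (simp_all only:)
    qed
    have "(mat_adjoint ?L * E k) $$ (i, j) = cnj ((mat_adjoint (E k) * ?L) $$ (j, i))"
      by (rule swap[symmetric]) simp
    also have "\<dots> = (\<Sum>f\<in>carrier G. cnj (c f) * cnj ((mat_adjoint (E k) * E f) $$ (j, i)))"
      using index_mult_op_combination[OF R(6)[OF k] R(1) j i] by simp
    also have "\<dots> = (\<Sum>f\<in>carrier G. cnj (c f) * (mat_adjoint (E f) * E k) $$ (i, j))"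
      by (intro sum.cong refl) (simp only: swap[OF R(1)])
    finally show ?thesis .
  qed
  have "(mat_adjoint ?L * ?L) $$ (i, j) = (\<Sum>k\<in>carrier G. c k * (mat_adjoint ?L * E k) $$ (i, j))"
    by (rule index_mult_op_combination[OF mat_adjoint_carrier[OF op_combination_carrier] R(1) i j])
  also have "\<dots> = (\<Sum>k\<in>carrier G. \<Sum>f\<in>carrier G. cnj (c f) * c k * (mat_adjoint (E f) * E k) $$ (i, j))"
    by (intro sum.cong refl) (simp only: * sum_distrib_left mult.assoc mult.left_commute)
  also have "\<dots> = (\<Sum>f\<in>carrier G. \<Sum>k\<in>carrier G. cnj (c f) * c k * (mat_adjoint (E f) * E k) $$ (i, j))"
    by (rule sum.swap)
  also have "\<dots> = (\<Sum>f\<in>carrier G. \<Sum>g\<in>carrier G. cnj (c f) * c (f \<otimes> g) * (mat_adjoint (E f) * E (f \<otimes> g)) $$ (i, j))"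
    by (intro sum.cong refl sum_translate[symmetric])
  also have "\<dots> = (\<Sum>f\<in>carrier G. \<Sum>g\<in>carrier G. cnj (\<gamma> f g) * cnj (c f) * c (f \<otimes> g) * E g $$ (i, j))"
    by (intro sum.cong refl) (simp add: proj_unitary_rep_adjoint_mult[OF E] R(2,3) i j)
  also have "\<dots> = (\<Sum>g\<in>carrier G. \<Sum>f\<in>carrier G. cnj (\<gamma> f g) * cnj (c f) * c (f \<otimes> g) * E g $$ (i, j))"
    by (rule sum.swap)
  also have "\<dots> = op_combination G n E (correlation \<gamma> c) $$ (i, j)"
    using i j by (simp add: index_op_combination correlation_def sum_distrib_right)
  finally show "(mat_adjoint ?L * ?L) $$ (i, j) = op_combination G n E (correlation \<gamma> c) $$ (i, j)" .
qed auto

text \<open>A left inverse of a square matrix is also a right inverse, so the single product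
  computed above decides unitarity.\<close>

lemma unitary_mat_op_combination_iff:
  assumes E: "proj_unitary_rep G n \<gamma> E"
  shows "unitary_mat n (op_combination G n E c) \<longleftrightarrow> op_combination G n E (correlation \<gamma> c) = 1\<^sub>m n"
  unfolding unitary_mat_def adjoint_op_combination_mult_self[OF E]
  using mat_mult_left_right_inverse[OF mat_adjoint_carrier[OF op_combination_carrier] op_combination_carrier]
    adjoint_op_combination_mult_self[OF E, of c] by auto

text \<open>Since \<open>n > 0\<close>, \<open>Y\<close> has a complex eigenvalue. Its eigenspace is
  nonzero and invariant under all \<open>D f\<close>, hence the whole space.\<close>

lemma schur_scalar:
  assumes irr: "irreducible_rep G n D"
    and D: "\<And>f. f \<in> carrier G \<Longrightarrow> D f \<in> carrier_mat n n"
    and Y: "Y \<in> carrier_mat n n"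
    and comm: "\<And>f. f \<in> carrier G \<Longrightarrow> Y * D f = D f * Y"
  shows "\<exists>a. Y = a \<cdot>\<^sub>m 1\<^sub>m n"
proof -
  have "n > 0" using irr by (simp add: irreducible_rep_def)
  then obtain a where "a \<in> spectrum Y" using spectrum_non_empty[OF Y] by auto
  then obtain v where v: "v \<in> carrier_vec n" "v \<noteq> 0\<^sub>v n" "Y *\<^sub>v v = a \<cdot>\<^sub>v v"
    using Y by (auto simp: spectrum_def eigenvalue_def eigenvector_def)
  define W where "W = {v \<in> carrier_vec n. Y *\<^sub>v v = a \<cdot>\<^sub>v v}"
  have "D f *\<^sub>v w \<in> W" if f: "f \<in> carrier G" and w: "w \<in> W" for f w
  proof -
    have wc: "w \<in> carrier_vec n" and wY: "Y *\<^sub>v w = a \<cdot>\<^sub>v w" using w by (auto simp: W_def)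
    have "Y *\<^sub>v (D f *\<^sub>v w) = (Y * D f) *\<^sub>v w" using assoc_mult_mat_vec[OF Y D[OF f] wc] by simp
    also have "\<dots> = D f *\<^sub>v (a \<cdot>\<^sub>v w)"
      unfolding comm[OF f] assoc_mult_mat_vec[OF D[OF f] Y wc] wY ..
    also have "\<dots> = a \<cdot>\<^sub>v (D f *\<^sub>v w)" by (rule mult_mat_vec[OF D[OF f] wc])
    finally show ?thesis using mult_mat_vec_carrier[OF D[OF f] wc] by (simp add: W_def)
  qed
  moreover have "VectorSpace.subspace class_ring W (module_vec TYPE(complex) n)"
    unfolding W_def by (rule eigenspace_subspace[OF Y])
  ultimately have "W = {0\<^sub>v n} \<or> W = carrier_vec n"
    using irr unfolding irreducible_rep_def by blast
  moreover have "v \<in> W" using v by (simp add: W_def)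
  ultimately have all: "W = carrier_vec n" using v(2) by blast
  have "Y = a \<cdot>\<^sub>m 1\<^sub>m n"
  proof (rule eq_mat_if_eq_mult_vec[of _ n n])
    fix v :: "complex vec" assume v: "v \<in> carrier_vec n"
    then have "Y *\<^sub>v v = a \<cdot>\<^sub>v v" using all by (auto simp: W_def)
    also have "\<dots> = (a \<cdot>\<^sub>m 1\<^sub>m n) *\<^sub>v v" using v by (intro eq_vecI) auto
    finally show "Y *\<^sub>v v = (a \<cdot>\<^sub>m 1\<^sub>m n) *\<^sub>v v" .
  qed (use Y in auto)
  then show ?thesis ..
qed

text \<open>The assumption \<open>inv\<close> says that the range of \<open>J\<close> is invariant.
  Unitarity survives because \<open>J E'(f) = E(f) J\<close> makes
  \<open>E'(f)\<^sup>\<dagger> E'(f)\<close> collapse to \<open>J\<^sup>\<dagger> J\<close>. The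
  last conclusion expresses invariance of the orthogonal complement.\<close>

lemma proj_unitary_rep_compress:
  assumes E: "proj_unitary_rep G n \<gamma> E"
    and J: "J \<in> carrier_mat n m" and iso: "mat_adjoint J * J = 1\<^sub>m m"
    and inv: "\<And>f. f \<in> carrier G \<Longrightarrow> J * (mat_adjoint J * (E f * J)) = E f * J"
  defines "E' \<equiv> \<lambda>f. mat_adjoint J * (E f * J)"
  shows "proj_unitary_rep G m \<gamma> E'" "f \<in> carrier G \<Longrightarrow> J * E' f = E f * J"
    "f \<in> carrier G \<Longrightarrow> mat_adjoint J * E f = E' f * mat_adjoint J"
proof -
  note R = proj_unitary_repD[OF E]
  have JA: "mat_adjoint J \<in> carrier_mat m n" using J by simp
  have EJ: "E f * J \<in> carrier_mat n m" if "f \<in> carrier G" for f using R(1)[OF that] J by simp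
  have E'c: "E' f \<in> carrier_mat m m" if "f \<in> carrier G" for f
    unfolding E'_def using JA EJ[OF that] by simp
  show JE': "J * E' f = E f * J" if "f \<in> carrier G" for f
    unfolding E'_def using inv[OF that] .
  have unit: "mat_adjoint (E' f) * E' f = 1\<^sub>m m" if f: "f \<in> carrier G" for f
  proof -
    have "mat_adjoint (E' f) * E' f = mat_adjoint (E f * J) * J * E' f"
      unfolding E'_def using mat_adjoint_mult[OF JA EJ[OF f]] by simp
    also have "\<dots> = mat_adjoint (E f * J) * (J * E' f)"
      using assoc_mult_mat[OF mat_adjoint_carrier[OF EJ[OF f]] J E'c[OF f]] .
    also have "\<dots> = mat_adjoint J * mat_adjoint (E f) * (E f * J)"
      unfolding JE'[OF f] mat_adjoint_mult[OF R(1)[OF f] J] ..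
    also have "\<dots> = mat_adjoint J * (mat_adjoint (E f) * (E f * J))"
      by (rule assoc_mult_mat[OF JA R(6)[OF f] EJ[OF f]])
    also have "mat_adjoint (E f) * (E f * J) = mat_adjoint (E f) * E f * J"
      by (rule assoc_mult_mat[OF R(6)[OF f] R(1)[OF f] J, symmetric])
    finally show ?thesis using iso R(4)[OF f] J by simp
  qed
  have unit': "E' f * mat_adjoint (E' f) = 1\<^sub>m m" if f: "f \<in> carrier G" for f
    using mat_mult_left_right_inverse[OF mat_adjoint_carrier[OF E'c[OF f]] E'c[OF f] unit[OF f]] .
  have mult: "E' f * E' g = \<gamma> f g \<cdot>\<^sub>m E' (f \<otimes> g)" if f: "f \<in> carrier G" and g: "g \<in> carrier G" for f g
  proof -
    have fg: "f \<otimes> g \<in> carrier G" using f g by simp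
    have "E' f * E' g = mat_adjoint J * (E f * J * E' g)"
      using assoc_mult_mat[OF JA EJ[OF f] E'c[OF g]] by (simp add: E'_def)
    also have "E f * J * E' g = E f * (J * E' g)"
      by (rule assoc_mult_mat[OF R(1)[OF f] J E'c[OF g]])
    also have "\<dots> = E f * E g * J"
      unfolding JE'[OF g] by (rule assoc_mult_mat[OF R(1)[OF f] R(1)[OF g] J, symmetric])
    also have "\<dots> = \<gamma> f g \<cdot>\<^sub>m (E (f \<otimes> g) * J)"
      unfolding R(8)[OF f g] by (rule mult_smult_assoc_mat[OF R(1)[OF fg] J])
    also have "mat_adjoint J * \<dots> = \<gamma> f g \<cdot>\<^sub>m E' (f \<otimes> g)"
      unfolding E'_def by (rule mult_smult_distrib[OF JA EJ[OF fg]])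
    finally show ?thesis .
  qed
  show "proj_unitary_rep G m \<gamma> E'"
    unfolding proj_unitary_rep_def unitary_mat_def
  proof (intro ballI conjI)
    fix f g assume f: "f \<in> carrier G" and g: "g \<in> carrier G"
    show "cmod (\<gamma> f g) = 1" by (rule R(7)[OF f g])
    show "E' f * E' g = \<gamma> f g \<cdot>\<^sub>m E' (f \<otimes> g)" by (rule mult[OF f g])
  qed (rule E'c unit unit'; assumption)+
  show "mat_adjoint J * E f = E' f * mat_adjoint J" if f: "f \<in> carrier G" for f
  proof -
    \<comment> \<open>Multiply \<open>J E'(f) = E(f) J\<close> by
      \<open>E(f)\<^sup>\<dagger>\<close> on the left and by \<open>E'(f)\<^sup>\<dagger>\<close> on
      the right; both are inverses. The adjoint of the result is the claim.\<close>
    have "mat_adjoint (E f) * J = J * mat_adjoint (E' f)"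
    proof -
      have "mat_adjoint (E f) * J = mat_adjoint (E f) * (J * (E' f * mat_adjoint (E' f)))"
        using unit'[OF f] J by simp
      also have "J * (E' f * mat_adjoint (E' f)) = E f * J * mat_adjoint (E' f)"
        unfolding JE'[OF f, symmetric]
        by (rule assoc_mult_mat[OF J E'c[OF f] mat_adjoint_carrier[OF E'c[OF f]], symmetric])
      also have "\<dots> = E f * (J * mat_adjoint (E' f))"
        by (rule assoc_mult_mat[OF R(1)[OF f] J mat_adjoint_carrier[OF E'c[OF f]]])
      also have "mat_adjoint (E f) * \<dots> = mat_adjoint (E f) * E f * (J * mat_adjoint (E' f))"
        by (rule assoc_mult_mat[OF R(6)[OF f] R(1)[OF f], symmetric])
          (rule mult_carrier_mat[OF J mat_adjoint_carrier[OF E'c[OF f]]])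
      finally show ?thesis using R(4)[OF f] J E'c[OF f] by simp
    qed
    from arg_cong[OF this, of mat_adjoint]
    show ?thesis
      unfolding mat_adjoint_mult[OF R(6)[OF f] J] mat_adjoint_mult[OF J mat_adjoint_carrier[OF E'c[OF f]]]
      by simp
  qed
qed

lemma op_combination_eq_0_compress:
  assumes E: "proj_unitary_rep G n \<gamma> E"
    and J: "J \<in> carrier_mat n m" and iso: "mat_adjoint J * J = 1\<^sub>m m"
    and inv: "\<And>f. f \<in> carrier G \<Longrightarrow> J * (mat_adjoint J * (E f * J)) = E f * J"
    and zero: "op_combination G m (\<lambda>f. mat_adjoint J * (E f * J)) u = 0\<^sub>m m m"
  shows "op_combination G n E u * (J * mat_adjoint J) = 0\<^sub>m n n"
proof -
  note S = proj_unitary_rep_compress[OF E J iso inv, simplified]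
  have "op_combination G n E u * J = J * 0\<^sub>m m m"
    unfolding zero[symmetric]
    by (rule op_combination_intertwine[OF J proj_unitary_repD(1)[OF E] proj_unitary_repD(1)[OF S(1)] S(2), symmetric])
  then show ?thesis
    using J assoc_mult_mat[OF op_combination_carrier J mat_adjoint_carrier[OF J]]
    by (metis left_mult_zero_mat mat_adjoint_carrier right_mult_zero_mat)
qed

text \<open>An irreducible \<open>E\<close> is equivalent to some \<open>D l\<close>, and the
  equivalence is a nonzero intertwiner, so the first alternative must hold and carries over to
  \<open>E\<close>. A reducible \<open>E\<close> splits into an invariant subspace and its
  complement, both inheriting the hypothesis, and the two projections sum to the identity.\<close>

lemma op_combination_eq_0_of_irreps:
  assumes complete: "complete_irreps G \<gamma> \<kappa> d D"
    and "proj_unitary_rep G n \<gamma> E"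
    and "\<And>l. l \<in> {1..\<kappa>} \<Longrightarrow> op_combination G (d l) (D l) u = 0\<^sub>m (d l) (d l) \<or>
      (\<forall>J\<in>carrier_mat n (d l). (\<forall>f\<in>carrier G. J * D l f = E f * J) \<longrightarrow> J = 0\<^sub>m n (d l))"
  shows "op_combination G n E u = 0\<^sub>m n n"
  using assms(2,3)
proof (induction n arbitrary: E rule: less_induct)
  case (less n)
  note E = less.prems(1) and H = less.prems(2)
  note R = proj_unitary_repD[OF E]
  let ?L = "op_combination G n E u"
  show ?case
  proof (cases "irreducible_rep G n E")
    case True
    then have "n > 0" by (simp add: irreducible_rep_def)
    from True E complete obtain l where l: "l \<in> {1..\<kappa>}" and eq: "equivalent_reps G n E (d l) (D l)"
      unfolding complete_irreps_def by blast
    from eq obtain S where dl: "d l = n" and S: "S \<in> carrier_mat n n" and inv: "invertible_mat S"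
      and SE: "\<And>f. f \<in> carrier G \<Longrightarrow> S * E f = D l f * S"
      unfolding equivalent_reps_def by auto
    have Drep: "proj_unitary_rep G n \<gamma> (D l)"
      using complete l dl unfolding complete_irreps_def by auto
    note RD = proj_unitary_repD[OF Drep]
    from inv obtain S' where SS': "S * S' = 1\<^sub>m n" and S'S: "S' * S = 1\<^sub>m (dim_row S')"
      using S unfolding invertible_mat_def inverts_mat_def by auto
    have S': "S' \<in> carrier_mat n n"
    proof (rule carrier_matI)
      show "dim_col S' = n" using arg_cong[OF SS', of dim_col] by simp
      show "dim_row S' = n" using arg_cong[OF S'S, of dim_col] S by simp
    qed
    have S'D: "S' * D l f = E f * S'" if f: "f \<in> carrier G" for f
    proof -
      have "S' * D l f = S' * (D l f * (S * S'))" using SS' RD(1)[OF f] by simp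
      also have "D l f * (S * S') = S * E f * S'"
        unfolding SE[OF f] by (rule assoc_mult_mat[OF RD(1)[OF f] S S', symmetric])
      also have "\<dots> = S * (E f * S')" by (rule assoc_mult_mat[OF S R(1)[OF f] S'])
      also have "S' * \<dots> = S' * S * (E f * S')"
        by (rule assoc_mult_mat[OF S' S mult_carrier_mat[OF R(1)[OF f] S'], symmetric])
      finally show ?thesis using S'S S' R(1)[OF f] by simp
    qed
    \<comment> \<open>Here \<open>n > 0\<close> matters: a nonzero intertwiner excludes the second
      alternative for this \<open>l\<close>.\<close>
    have "S' \<noteq> 0\<^sub>m n n"
    proof
      assume "S' = 0\<^sub>m n n"
      then have "0\<^sub>m n n = (1\<^sub>m n :: complex mat)" using SS' S by simp
      from arg_cong[OF this, of "\<lambda>A. A $$ (0, 0)"] show False using \<open>n > 0\<close> by simp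
    qed
    then have "op_combination G n (D l) u = 0\<^sub>m n n"
      using H[OF l] S' S'D unfolding dl by blast
    then have "?L * S' = 0\<^sub>m n n"
    proof -
      have "?L * S' = S' * op_combination G n (D l) u"
        by (rule op_combination_intertwine[OF S' R(1) RD(1) S'D, symmetric])
      then show ?thesis using \<open>op_combination G n (D l) u = 0\<^sub>m n n\<close> S' by simp
    qed
    moreover have "?L * S' * S = ?L * (S' * S)" by (rule assoc_mult_mat[OF op_combination_carrier S' S])
    ultimately show ?thesis using S S' S'S by simp
  next
    case False
    \<comment> \<open>Irreducibility includes \<open>n > 0\<close>, so dimension zero lands in this
      case although it has no proper invariant subspace; it is settled separately.\<close>
    show ?thesis
    proof (cases "n = 0")
      case True
      then show ?thesis by (intro eq_matI) auto
    next
      case n0: False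
      from False n0 obtain W where W: "VectorSpace.subspace class_ring W (module_vec TYPE(complex) n)"
        and EW: "\<And>f w. f \<in> carrier G \<Longrightarrow> w \<in> W \<Longrightarrow> E f *\<^sub>v w \<in> W"
        and W0: "W \<noteq> {0\<^sub>v n}" and Wn: "W \<noteq> carrier_vec n"
        unfolding irreducible_rep_def by blast
      obtain J K m k where J: "J \<in> carrier_mat n m" and Ji: "mat_adjoint J * J = 1\<^sub>m m" and mn: "m < n"
        and JW: "\<And>x. x \<in> carrier_vec m \<Longrightarrow> J *\<^sub>v x \<in> W"
        and WJ: "\<And>w. w \<in> W \<Longrightarrow> J *\<^sub>v (mat_adjoint J *\<^sub>v w) = w"
        and K: "K \<in> carrier_mat n k" and Ki: "mat_adjoint K * K = 1\<^sub>m k" and kn: "k < n"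
        and WK: "\<And>v. v \<in> carrier_vec n \<Longrightarrow> mat_adjoint J *\<^sub>v v = 0\<^sub>v m \<Longrightarrow> K *\<^sub>v (mat_adjoint K *\<^sub>v v) = v"
        and JK: "mat_adjoint J * K = 0\<^sub>m m k"
        and total: "J * mat_adjoint J + K * mat_adjoint K = 1\<^sub>m n"
        by (rule orthogonal_splitting[OF W W0 Wn]) (rule that; blast)
      have JA: "mat_adjoint J \<in> carrier_mat m n" and KA: "mat_adjoint K \<in> carrier_mat k n"
        using J K by auto
      \<comment> \<open>\<open>B\<close> stands for \<open>J\<close> and for \<open>K\<close>. An
        intertwiner \<open>X\<close> into the compressed representation becomes one into
        \<open>E\<close> after composition with \<open>B\<close>, and
        \<open>B\<^sup>\<dagger> B = 1\<close> recovers \<open>X\<close>; so the hypothesis on the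
        irreducibles descends to the smaller representation.\<close>
      have step: "?L * (B * mat_adjoint B) = 0\<^sub>m n n"
        if B: "B \<in> carrier_mat n b" and Bi: "mat_adjoint B * B = 1\<^sub>m b" and bn: "b < n"
          and inv: "\<And>f. f \<in> carrier G \<Longrightarrow> B * (mat_adjoint B * (E f * B)) = E f * B" for B b
      proof (rule op_combination_eq_0_compress[OF E B Bi inv])
        let ?E = "\<lambda>f. mat_adjoint B * (E f * B)"
        note S = proj_unitary_rep_compress[OF E B Bi inv, simplified]
        note RS = proj_unitary_repD[OF S(1)]
        show "op_combination G b ?E u = 0\<^sub>m b b"
        proof (rule less.IH[OF bn S(1)])
          fix l assume l: "l \<in> {1..\<kappa>}"
          have Dc: "D l f \<in> carrier_mat (d l) (d l)" if "f \<in> carrier G" for f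
            using complete l that proj_unitary_repD(1) unfolding complete_irreps_def by blast
          show "op_combination G (d l) (D l) u = 0\<^sub>m (d l) (d l) \<or>
            (\<forall>J\<in>carrier_mat b (d l). (\<forall>f\<in>carrier G. J * D l f = ?E f * J) \<longrightarrow> J = 0\<^sub>m b (d l))"
          proof (cases "op_combination G (d l) (D l) u = 0\<^sub>m (d l) (d l)")
            case False
            have "X = 0\<^sub>m b (d l)" if X: "X \<in> carrier_mat b (d l)"
              and XD: "\<And>f. f \<in> carrier G \<Longrightarrow> X * D l f = ?E f * X" for X
            proof -
              have BX: "B * X \<in> carrier_mat n (d l)" using B X by simp
              have "B * X * D l f = E f * (B * X)" if f: "f \<in> carrier G" for f
              proof -
                have "B * X * D l f = B * (X * D l f)" by (rule assoc_mult_mat[OF B X Dc[OF f]])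
                also have "\<dots> = B * ?E f * X"
                  unfolding XD[OF f] by (rule assoc_mult_mat[OF B RS(1)[OF f] X, symmetric])
                also have "\<dots> = E f * (B * X)"
                  unfolding inv[OF f] by (rule assoc_mult_mat[OF R(1)[OF f] B X])
                finally show ?thesis .
              qed
              then have "B * X = 0\<^sub>m n (d l)" using H[OF l] False BX by blast
              then have "mat_adjoint B * B * X = mat_adjoint B * 0\<^sub>m n (d l)"
                using assoc_mult_mat[OF mat_adjoint_carrier[OF B] B X] by simp
              then show ?thesis using Bi X B by simp
            qed
            then show ?thesis by blast
          qed simp
        qed
      qed (use B in auto)
      have invJ: "J * (mat_adjoint J * (E f * J)) = E f * J" if f: "f \<in> carrier G" for f
      proof (rule eq_mat_if_eq_mult_vec[of _ n m])
        have EJ: "E f * J \<in> carrier_mat n m" using R(1)[OF f] J by simp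
        show "E f * J \<in> carrier_mat n m" "J * (mat_adjoint J * (E f * J)) \<in> carrier_mat n m"
          using EJ mult_carrier_mat[OF J mult_carrier_mat[OF JA EJ]] .
        fix x :: "complex vec" assume x: "x \<in> carrier_vec m"
        have EJx: "(E f * J) *\<^sub>v x = E f *\<^sub>v (J *\<^sub>v x)" by (rule assoc_mult_mat_vec[OF R(1)[OF f] J x])
        have "J * (mat_adjoint J * (E f * J)) *\<^sub>v x = J *\<^sub>v (mat_adjoint J *\<^sub>v ((E f * J) *\<^sub>v x))"
          using assoc_mult_mat_vec[OF J mult_carrier_mat[OF JA EJ] x] assoc_mult_mat_vec[OF JA EJ x] by simp
        also have "\<dots> = (E f * J) *\<^sub>v x"
          unfolding EJx by (rule WJ[OF EW[OF f JW[OF x]]])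
        finally show "J * (mat_adjoint J * (E f * J)) *\<^sub>v x = (E f * J) *\<^sub>v x" .
      qed
      note SJ = proj_unitary_rep_compress[OF E J Ji invJ, simplified]
      \<comment> \<open>\<open>J\<^sup>\<dagger> E(f) K\<close> equals the compressed operator times
        \<open>J\<^sup>\<dagger> K = 0\<close>, so \<open>E(f) K\<close> maps into the kernel of
        \<open>J\<^sup>\<dagger>\<close>, on which \<open>K K\<^sup>\<dagger>\<close> is the
        identity.\<close>
      have invK: "K * (mat_adjoint K * (E f * K)) = E f * K" if f: "f \<in> carrier G" for f
      proof (rule eq_mat_if_eq_mult_vec[of _ n k])
        let ?E = "mat_adjoint J * (E f * J)"
        have EK: "E f * K \<in> carrier_mat n k" using R(1)[OF f] K by simp
        show "E f * K \<in> carrier_mat n k" "K * (mat_adjoint K * (E f * K)) \<in> carrier_mat n k"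
          using EK mult_carrier_mat[OF K mult_carrier_mat[OF KA EK]] .
        fix x :: "complex vec" assume x: "x \<in> carrier_vec k"
        have v: "(E f * K) *\<^sub>v x \<in> carrier_vec n" using EK x by simp
        have "mat_adjoint J * (E f * K) = mat_adjoint J * E f * K"
          by (rule assoc_mult_mat[OF JA R(1)[OF f] K, symmetric])
        also have "\<dots> = ?E * (mat_adjoint J * K)"
          unfolding SJ(3)[OF f] by (rule assoc_mult_mat[OF proj_unitary_repD(1)[OF SJ(1) f] JA K])
        also have "\<dots> = 0\<^sub>m m k" unfolding JK using J by simp
        finally have "mat_adjoint J *\<^sub>v ((E f * K) *\<^sub>v x) = 0\<^sub>v m"
          using assoc_mult_mat_vec[OF JA EK x] zero_mat_mult_vec[OF x, of m] by simp
        from WK[OF v this]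
        show "K * (mat_adjoint K * (E f * K)) *\<^sub>v x = (E f * K) *\<^sub>v x"
          using assoc_mult_mat_vec[OF K mult_carrier_mat[OF KA EK] x] assoc_mult_mat_vec[OF KA EK x] by simp
      qed
      have "?L * (J * mat_adjoint J + K * mat_adjoint K) = 0\<^sub>m n n"
        using mult_add_distrib_mat[OF op_combination_carrier mult_carrier_mat[OF J JA] mult_carrier_mat[OF K KA]]
          step[OF J Ji mn invJ] step[OF K Ki kn invK] by simp
      then show ?thesis unfolding total by simp
    qed
  qed
qed

subsection \<open>Schur orthogonality\<close>

text \<open>Taking adjoints puts adjoints on the representation operators; multiplication by
  \<open>D' g\<close> on the left and \<open>D g\<close> on the right removes them by
  unitarity.\<close>

lemma intertwiner_adjoint:
  assumes D: "proj_unitary_rep G n \<gamma> D" and D': "proj_unitary_rep G m \<gamma> D'"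
    and Y: "Y \<in> carrier_mat n m" and YD: "Y * D' g = D g * Y" and g: "g \<in> carrier G"
  shows "mat_adjoint Y * D g = D' g * mat_adjoint Y"
proof -
  note R = proj_unitary_repD[OF D g] and R' = proj_unitary_repD[OF D' g]
  have YA: "mat_adjoint Y \<in> carrier_mat m n" using Y by simp
  have adj: "mat_adjoint (D' g) * mat_adjoint Y = mat_adjoint Y * mat_adjoint (D g)"
    using arg_cong[OF YD, of mat_adjoint] mat_adjoint_mult[OF Y R'(1)] mat_adjoint_mult[OF R(1) Y] by simp
  have "mat_adjoint Y * D g = D' g * mat_adjoint (D' g) * (mat_adjoint Y * D g)"
    using R'(5) left_mult_one_mat[OF mult_carrier_mat[OF YA R(1)]] by simp
  also have "\<dots> = D' g * (mat_adjoint (D' g) * (mat_adjoint Y * D g))"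
    by (rule assoc_mult_mat[OF R'(1) R'(6) mult_carrier_mat[OF YA R(1)]])
  also have "mat_adjoint (D' g) * (mat_adjoint Y * D g) = mat_adjoint (D' g) * mat_adjoint Y * D g"
    by (rule assoc_mult_mat[OF R'(6) YA R(1), symmetric])
  also have "\<dots> = mat_adjoint Y * (mat_adjoint (D g) * D g)"
    unfolding adj by (rule assoc_mult_mat[OF YA R(6) R(1)])
  finally show ?thesis unfolding R(4) right_mult_one_mat[OF YA] .
qed

text \<open>\<open>Y\<^sup>\<dagger> Y\<close> is an intertwiner of \<open>D'\<close> with itself,
  so Schur's lemma applies. A nonzero scalar here means that \<open>Y\<close> can be cancelled from
  the left.\<close>

lemma intertwiner_adjoint_mult_scalar:
  assumes D: "proj_unitary_rep G n \<gamma> D" and D': "proj_unitary_rep G m \<gamma> D'"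
    and irr: "irreducible_rep G m D'"
    and Y: "Y \<in> carrier_mat n m" and YD: "\<And>g. g \<in> carrier G \<Longrightarrow> Y * D' g = D g * Y"
  shows "\<exists>a. mat_adjoint Y * Y = a \<cdot>\<^sub>m 1\<^sub>m m"
proof (rule schur_scalar[OF irr proj_unitary_repD(1)[OF D']])
  have YA: "mat_adjoint Y \<in> carrier_mat m n" using Y by simp
  show "mat_adjoint Y * Y \<in> carrier_mat m m" by (rule mult_carrier_mat[OF YA Y])
  fix g assume g: "g \<in> carrier G"
  note R = proj_unitary_repD(1)[OF D g] and R' = proj_unitary_repD(1)[OF D' g]
  have "mat_adjoint Y * Y * D' g = mat_adjoint Y * (D g * Y)"
    using assoc_mult_mat[OF YA Y R'] YD[OF g] by simp
  also have "\<dots> = D' g * mat_adjoint Y * Y"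
    using assoc_mult_mat[OF YA R Y] intertwiner_adjoint[OF D D' Y YD[OF g] g] by simp
  finally show "mat_adjoint Y * Y * D' g = D' g * (mat_adjoint Y * Y)"
    using assoc_mult_mat[OF R' YA Y] by simp
qed

text \<open>
  Both \<open>Y\<^sup>\<dagger> Y\<close> and \<open>Y Y\<^sup>\<dagger>\<close> are scalar. If \<open>Y \<noteq> 0\<close> the scalars agree, and comparing traces forces
  equal dimensions, so \<open>Y\<close> is an equivalence.
\<close>

lemma intertwiner_eq_0:
  assumes D: "proj_unitary_rep G n \<gamma> D" and D': "proj_unitary_rep G m \<gamma> D'"
    and irr: "irreducible_rep G n D" and irr': "irreducible_rep G m D'"
    and neq: "\<not> equivalent_reps G m D' n D"
    and Y: "Y \<in> carrier_mat n m" and YD: "\<And>g. g \<in> carrier G \<Longrightarrow> Y * D' g = D g * Y"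
  shows "Y = 0\<^sub>m n m"
proof (rule ccontr)
  assume Y0: "Y \<noteq> 0\<^sub>m n m"
  have YA: "mat_adjoint Y \<in> carrier_mat m n" using Y by simp
  obtain a where a: "mat_adjoint Y * Y = a \<cdot>\<^sub>m 1\<^sub>m m"
    using intertwiner_adjoint_mult_scalar[OF D D' irr' Y YD] by auto
  obtain b where b: "Y * mat_adjoint Y = b \<cdot>\<^sub>m 1\<^sub>m n"
    using intertwiner_adjoint_mult_scalar[OF D' D irr YA intertwiner_adjoint[OF D D' Y YD]] by auto
  \<comment> \<open>Bracketing \<open>Y Y\<^sup>\<dagger> Y\<close> in the two possible ways
    compares the scalars.\<close>
  have "b \<cdot>\<^sub>m 1\<^sub>m n * Y = Y * (a \<cdot>\<^sub>m 1\<^sub>m m)"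
    using assoc_mult_mat[OF Y YA Y] a b by simp
  then have ab: "b \<cdot>\<^sub>m Y = a \<cdot>\<^sub>m Y"
    using Y mult_smult_assoc_mat[OF one_carrier_mat Y] mult_smult_distrib[OF Y one_carrier_mat] by simp
  obtain i j where ij: "i < n" "j < m" "Y $$ (i, j) \<noteq> 0"
    using Y0 Y by (metis (no_types) carrier_matD eq_matI index_zero_mat)
  then have "b = a" using arg_cong[OF ab, of "\<lambda>A. A $$ (i, j)"] Y by auto
  have "a \<noteq> 0"
  proof
    assume "a = 0"
    then have "mat_adjoint Y * Y = 0\<^sub>m m m" using a by (auto intro!: eq_matI)
    then show False using adjoint_mult_self_eq_0_imp[OF Y] Y0 by blast
  qed
  have "a * of_nat m = b * of_nat n"
    using mat_trace_mult_comm[OF YA Y] a b by simp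
  then have "m = n" using \<open>b = a\<close> \<open>a \<noteq> 0\<close> by simp
  have "invertible_mat Y"
    unfolding invertible_mat_def inverts_mat_def
  proof (intro conjI exI)
    show "square_mat Y" using Y \<open>m = n\<close> by simp
    show "Y * (inverse a \<cdot>\<^sub>m mat_adjoint Y) = 1\<^sub>m (dim_row Y)"
      unfolding mult_smult_distrib[OF Y YA] b using Y \<open>b = a\<close> \<open>a \<noteq> 0\<close> by (auto intro!: eq_matI)
    show "(inverse a \<cdot>\<^sub>m mat_adjoint Y) * Y = 1\<^sub>m (dim_row (inverse a \<cdot>\<^sub>m mat_adjoint Y))"
      unfolding mult_smult_assoc_mat[OF YA Y] a using Y \<open>a \<noteq> 0\<close> by (auto intro!: eq_matI)
  qed
  then have "equivalent_reps G m D' n D"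
    unfolding equivalent_reps_def using \<open>m = n\<close> Y YD by blast
  then show False using neq by simp
qed

text \<open>Group averages between representations of different dimensions are rectangular, unlike
  the values of \<open>op_combination\<close>.\<close>

definition mat_sum :: "nat \<Rightarrow> nat \<Rightarrow> ('a \<Rightarrow> complex mat) \<Rightarrow> complex mat" where
  "mat_sum n m X = mat n m (\<lambda>(i, j). \<Sum>f\<in>carrier G. X f $$ (i, j))"

lemma mat_sum_carrier [simp]: "mat_sum n m X \<in> carrier_mat n m"
  by (simp add: mat_sum_def)

lemma mult_mat_sum:
  assumes A: "A \<in> carrier_mat k n" and X: "\<And>f. f \<in> carrier G \<Longrightarrow> X f \<in> carrier_mat n m"
  shows "A * mat_sum n m X = mat_sum k m (\<lambda>f. A * X f)"
proof (rule eq_matI)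
  fix i j assume "i < dim_row (mat_sum k m (\<lambda>f. A * X f))" "j < dim_col (mat_sum k m (\<lambda>f. A * X f))"
  then have ij: "i < k" "j < m" by (auto simp: mat_sum_def)
  have "(A * mat_sum n m X) $$ (i, j) = (\<Sum>l<n. \<Sum>f\<in>carrier G. A $$ (i, l) * X f $$ (l, j))"
    unfolding index_mult_mat_sum[OF A mat_sum_carrier ij]
    using ij by (intro sum.cong) (auto simp: mat_sum_def sum_distrib_left)
  also have "\<dots> = (\<Sum>f\<in>carrier G. \<Sum>l<n. A $$ (i, l) * X f $$ (l, j))" by (rule sum.swap)
  also have "\<dots> = (\<Sum>f\<in>carrier G. (A * X f) $$ (i, j))"
    by (intro sum.cong refl index_mult_mat_sum[OF A X ij, symmetric])
  finally show "(A * mat_sum n m X) $$ (i, j) = mat_sum k m (\<lambda>f. A * X f) $$ (i, j)"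
    using ij by (simp add: mat_sum_def)
qed (use A in \<open>auto simp: mat_sum_def\<close>)

lemma mat_sum_mult:
  assumes A: "A \<in> carrier_mat m k" and X: "\<And>f. f \<in> carrier G \<Longrightarrow> X f \<in> carrier_mat n m"
  shows "mat_sum n m X * A = mat_sum n k (\<lambda>f. X f * A)"
proof (rule eq_matI)
  fix i j assume "i < dim_row (mat_sum n k (\<lambda>f. X f * A))" "j < dim_col (mat_sum n k (\<lambda>f. X f * A))"
  then have ij: "i < n" "j < k" by (auto simp: mat_sum_def)
  have "(mat_sum n m X * A) $$ (i, j) = (\<Sum>l<m. \<Sum>f\<in>carrier G. X f $$ (i, l) * A $$ (l, j))"
    unfolding index_mult_mat_sum[OF mat_sum_carrier A ij]
    using ij by (intro sum.cong) (auto simp: mat_sum_def sum_distrib_right)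
  also have "\<dots> = (\<Sum>f\<in>carrier G. \<Sum>l<m. X f $$ (i, l) * A $$ (l, j))" by (rule sum.swap)
  also have "\<dots> = (\<Sum>f\<in>carrier G. (X f * A) $$ (i, j))"
    by (intro sum.cong refl index_mult_mat_sum[OF X A ij, symmetric])
  finally show "(mat_sum n m X * A) $$ (i, j) = mat_sum n k (\<lambda>f. X f * A) $$ (i, j)"
    using ij by (simp add: mat_sum_def)
qed (use A in \<open>auto simp: mat_sum_def\<close>)

lemma mat_trace_mat_sum:
  assumes "\<And>f. f \<in> carrier G \<Longrightarrow> X f \<in> carrier_mat n n"
  shows "mat_trace (mat_sum n n X) = (\<Sum>f\<in>carrier G. mat_trace (X f))"
proof -
  have "mat_trace (mat_sum n n X) = (\<Sum>i<n. \<Sum>f\<in>carrier G. X f $$ (i, i))"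
    by (simp add: mat_trace_def mat_sum_def)
  also have "\<dots> = (\<Sum>f\<in>carrier G. \<Sum>i<n. X f $$ (i, i))" by (rule sum.swap)
  also have "\<dots> = (\<Sum>f\<in>carrier G. mat_trace (X f))"
    unfolding mat_trace_def by (intro sum.cong refl) (use carrier_matD(1)[OF assms] in simp)
  finally show ?thesis .
qed

text \<open>Left multiplication by \<open>D g\<close> moves the summand at \<open>f\<close> to the
  one at \<open>g \<otimes> f\<close>, with \<open>D' g\<close> appearing on the right. The phase
  \<open>\<gamma> g f\<close> produced by \<open>D\<close> is the one absorbed by \<open>D'\<close>,
  because both have the same factor system.\<close>

lemma averaged_intertwines:
  assumes D: "proj_unitary_rep G n \<gamma> D" and D': "proj_unitary_rep G m \<gamma> D'"
    and X: "X \<in> carrier_mat n m" and g: "g \<in> carrier G"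
  defines "Y \<equiv> mat_sum n m (\<lambda>f. D f * (X * mat_adjoint (D' f)))"
  shows "Y * D' g = D g * Y"
proof -
  note R = proj_unitary_repD[OF D] and R' = proj_unitary_repD[OF D']
  let ?Z = "\<lambda>f. D f * (X * mat_adjoint (D' f))"
  have XD: "X * mat_adjoint (D' f) \<in> carrier_mat n m" if "f \<in> carrier G" for f
    using X R'(6)[OF that] by simp
  have Z: "?Z f \<in> carrier_mat n m" if "f \<in> carrier G" for f
    using R(1)[OF that] XD[OF that] by simp
  have Zg: "D g * ?Z f = ?Z (g \<otimes> f) * D' g" if f: "f \<in> carrier G" for f
  proof -
    have gf: "g \<otimes> f \<in> carrier G" using f g by simp
    have D'f: "mat_adjoint (D' (g \<otimes> f)) * D' g = \<gamma> g f \<cdot>\<^sub>m mat_adjoint (D' f)"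
      using arg_cong[OF proj_unitary_rep_adjoint_mult[OF D' g f], of mat_adjoint]
        mat_adjoint_mult[OF R'(6)[OF g] R'(1)[OF gf]] by (simp add: mat_adjoint_smult)
    have "D g * ?Z f = D g * D f * (X * mat_adjoint (D' f))"
      by (rule assoc_mult_mat[OF R(1)[OF g] R(1)[OF f] XD[OF f], symmetric])
    also have "\<dots> = \<gamma> g f \<cdot>\<^sub>m (D (g \<otimes> f) * (X * mat_adjoint (D' f)))"
      unfolding R(8)[OF g f] by (rule mult_smult_assoc_mat[OF R(1)[OF gf] XD[OF f]])
    also have "\<dots> = D (g \<otimes> f) * (\<gamma> g f \<cdot>\<^sub>m (X * mat_adjoint (D' f)))"
      by (rule mult_smult_distrib[OF R(1)[OF gf] XD[OF f], symmetric])
    also have "\<gamma> g f \<cdot>\<^sub>m (X * mat_adjoint (D' f)) = X * (mat_adjoint (D' (g \<otimes> f)) * D' g)"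
      unfolding D'f by (rule mult_smult_distrib[OF X R'(6)[OF f], symmetric])
    also have "\<dots> = X * mat_adjoint (D' (g \<otimes> f)) * D' g"
      by (rule assoc_mult_mat[OF X R'(6)[OF gf] R'(1)[OF g], symmetric])
    also have "D (g \<otimes> f) * \<dots> = ?Z (g \<otimes> f) * D' g"
      by (rule assoc_mult_mat[OF R(1)[OF gf] XD[OF gf] R'(1)[OF g], symmetric])
    finally show ?thesis .
  qed
  have "D g * Y = mat_sum n m (\<lambda>f. D g * ?Z f)"
    unfolding Y_def by (rule mult_mat_sum[OF R(1)[OF g] Z])
  also have "\<dots> = mat_sum n m (\<lambda>f. ?Z f * D' g)"
  proof -
    have "(\<Sum>f\<in>carrier G. (D g * ?Z f) $$ (i, j)) = (\<Sum>f\<in>carrier G. (?Z f * D' g) $$ (i, j))" for i j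
      using sum_translate[OF g, of "\<lambda>f. (?Z f * D' g) $$ (i, j)"] by (simp add: Zg cong: sum.cong)
    then show ?thesis by (simp only: mat_sum_def)
  qed
  also have "\<dots> = Y * D' g"
    unfolding Y_def by (rule mat_sum_mult[OF R'(1)[OF g] Z, symmetric])
  finally show ?thesis ..
qed

text \<open>Schur's lemma makes the average a scalar matrix. Each summand is a unitary conjugate of
  \<open>X\<close> and has its trace, so comparing traces fixes the scalar.\<close>

lemma averaged_scalar:
  assumes D: "proj_unitary_rep G n \<gamma> D" and irr: "irreducible_rep G n D" and X: "X \<in> carrier_mat n n"
  shows "mat_sum n n (\<lambda>f. D f * (X * mat_adjoint (D f)))
    = (of_nat (Coset.order G) * mat_trace X / of_nat n) \<cdot>\<^sub>m 1\<^sub>m n"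
proof -
  note R = proj_unitary_repD[OF D]
  let ?Y = "mat_sum n n (\<lambda>f. D f * (X * mat_adjoint (D f)))"
  have n0: "n > 0" using irr by (simp add: irreducible_rep_def)
  obtain a where a: "?Y = a \<cdot>\<^sub>m 1\<^sub>m n"
    using schur_scalar[OF irr R(1) mat_sum_carrier averaged_intertwines[OF D D X]] by blast
  have tr: "mat_trace (D f * (X * mat_adjoint (D f))) = mat_trace X" if f: "f \<in> carrier G" for f
    using mat_trace_mult_comm[OF R(1)[OF f] mult_carrier_mat[OF X R(6)[OF f]]]
      assoc_mult_mat[OF X R(6)[OF f] R(1)[OF f]] R(4)[OF f] X by simp
  have "mat_trace ?Y = (\<Sum>f\<in>carrier G. mat_trace (D f * (X * mat_adjoint (D f))))"
    by (rule mat_trace_mat_sum) (rule mult_carrier_mat[OF R(1) mult_carrier_mat[OF X R(6)]])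
  also have "\<dots> = of_nat (Coset.order G) * mat_trace X"
    by (simp add: tr Coset.order_def cong: sum.cong)
  finally have "a * of_nat n = of_nat (Coset.order G) * mat_trace X" unfolding a by simp
  then have "a = of_nat (Coset.order G) * mat_trace X / of_nat n" using n0 by (simp add: field_simps)
  then show ?thesis unfolding a by simp
qed

text \<open>\<open>X\<close> is a matrix unit, so that an entry of the average becomes a sum of
  products of single matrix elements, the form in which orthogonality is stated.\<close>

lemma index_averaged_unit:
  assumes D: "proj_unitary_rep G n \<gamma> D" and D': "proj_unitary_rep G m \<gamma> D'"
    and "i < n" "k < n" "j < m" "k' < m"
  defines "X \<equiv> mat n m (\<lambda>(p, q). if p = k \<and> q = k' then 1 else 0)"
  shows "mat_sum n m (\<lambda>f. D f * (X * mat_adjoint (D' f))) $$ (i, j)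
    = (\<Sum>f\<in>carrier G. D f $$ (i, k) * cnj (D' f $$ (j, k')))"
proof -
  note R = proj_unitary_repD[OF D] and R' = proj_unitary_repD[OF D']
  have X: "X \<in> carrier_mat n m" by (simp add: X_def)
  have XD: "(X * mat_adjoint (D' f)) $$ (p, j) = (if p = k then cnj (D' f $$ (j, k')) else 0)"
    if f: "f \<in> carrier G" and p: "p < n" for f p
  proof -
    have "(X * mat_adjoint (D' f)) $$ (p, j) = (\<Sum>q<m. X $$ (p, q) * mat_adjoint (D' f) $$ (q, j))"
      by (rule index_mult_mat_sum[OF X R'(6)[OF f] p \<open>j < m\<close>])
    also have "\<dots> = (\<Sum>q<m. if q = k' then (if p = k then cnj (D' f $$ (j, k')) else 0) else 0)"
      using p \<open>j < m\<close> R'(2,3)[OF f] by (intro sum.cong) (auto simp: X_def)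
    finally show ?thesis using \<open>k' < m\<close> by simp
  qed
  have "(D f * (X * mat_adjoint (D' f))) $$ (i, j) = D f $$ (i, k) * cnj (D' f $$ (j, k'))"
    if f: "f \<in> carrier G" for f
  proof -
    have "(D f * (X * mat_adjoint (D' f))) $$ (i, j) = (\<Sum>p<n. D f $$ (i, p) * (X * mat_adjoint (D' f)) $$ (p, j))"
      by (rule index_mult_mat_sum[OF R(1)[OF f] mult_carrier_mat[OF X R'(6)[OF f]] \<open>i < n\<close> \<open>j < m\<close>])
    also have "\<dots> = (\<Sum>p<n. if p = k then D f $$ (i, k) * cnj (D' f $$ (j, k')) else 0)"
      using XD[OF f] by (intro sum.cong) auto
    finally show ?thesis using \<open>k < n\<close> by simp
  qed
  then show ?thesis using assms(3,5) by (simp add: mat_sum_def)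
qed

text \<open>For \<open>l = l'\<close> the average is scalar and the trace of the matrix unit is the
  delta in \<open>k\<close> and \<open>k'\<close>; for \<open>l \<noteq> l'\<close> the average
  intertwines inequivalent irreducibles and vanishes.\<close>

lemma schur_orthogonality:
  assumes complete: "complete_irreps G \<gamma> \<kappa> d D"
    and l: "l \<in> {1..\<kappa>}" and l': "l' \<in> {1..\<kappa>}"
    and ik: "i < d l" "k < d l" and jk: "j < d l'" "k' < d l'"
  shows "(\<Sum>f\<in>carrier G. D l f $$ (i, k) * cnj (D l' f $$ (j, k')))
    = (if l = l' \<and> i = j \<and> k = k' then of_nat (Coset.order G) / of_nat (d l) else 0)"
proof -
  have D: "proj_unitary_rep G (d l) \<gamma> (D l)" "irreducible_rep G (d l) (D l)"
    and D': "proj_unitary_rep G (d l') \<gamma> (D l')" "irreducible_rep G (d l') (D l')"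
    using complete l l' unfolding complete_irreps_def by auto
  define X :: "complex mat" where "X = mat (d l) (d l') (\<lambda>(p, q). if p = k \<and> q = k' then 1 else 0)"
  define Y where "Y = mat_sum (d l) (d l') (\<lambda>f. D l f * (X * mat_adjoint (D l' f)))"
  have X: "X \<in> carrier_mat (d l) (d l')" by (simp add: X_def)
  have sum: "(\<Sum>f\<in>carrier G. D l f $$ (i, k) * cnj (D l' f $$ (j, k'))) = Y $$ (i, j)"
    unfolding Y_def X_def by (rule index_averaged_unit[OF D(1) D'(1) ik jk, symmetric])
  show ?thesis
  proof (cases "l = l'")
    case True
    have "Y = (of_nat (Coset.order G) * mat_trace X / of_nat (d l)) \<cdot>\<^sub>m 1\<^sub>m (d l)"
      using averaged_scalar[OF D, of X] X True unfolding Y_def by simp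
    moreover have "mat_trace X = (if k = k' then 1 else 0)"
    proof -
      have "mat_trace X = (\<Sum>p<d l. if p = k then (if k = k' then 1 else 0) else 0)"
        unfolding mat_trace_def using True by (intro sum.cong) (auto simp: X_def)
      then show ?thesis using ik by simp
    qed
    ultimately show ?thesis unfolding sum using True ik jk by simp
  next
    case False
    have "\<not> equivalent_reps G (d l') (D l') (d l) (D l)"
      using complete l l' False unfolding complete_irreps_def by metis
    then have "Y = 0\<^sub>m (d l) (d l')"
      using intertwiner_eq_0[OF D(1) D'(1) D(2) D'(2) _ mat_sum_carrier averaged_intertwines[OF D(1) D'(1) X]]
      unfolding Y_def by blast
    then show ?thesis unfolding sum using False ik jk by simp
  qed
qed

section \<open>Inversion of the Fourier transform\<close>

definition irrep_expansion ::
  "nat \<Rightarrow> (nat \<Rightarrow> nat) \<Rightarrow> (nat \<Rightarrow> 'a \<Rightarrow> complex mat) \<Rightarrow> (nat \<Rightarrow> complex mat) \<Rightarrow> 'a \<Rightarrow> complex" where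
  "irrep_expansion \<kappa> d D R f = (\<Sum>l=1..\<kappa>. of_nat (d l) / of_nat (Coset.order G) *
     (\<Sum>j<d l. \<Sum>k<d l. cnj (D l f $$ (j, k)) * R l $$ (j, k)))"

lemma order_pos: "Coset.order G > 0"
  using finite_carrier one_closed by (auto simp: Coset.order_def card_gt_0_iff)

text \<open>By orthogonality only the term with \<open>l' = l\<close>, \<open>j = p\<close>,
  \<open>k = q\<close> survives, and its weight \<open>d/N\<close> cancels the norm
  \<open>N/d\<close>. Arbitrary matrices \<open>R\<close> are thus the Fourier transform of some
  coefficient function.\<close>

lemma op_combination_irrep_expansion:
  assumes complete: "complete_irreps G \<gamma> \<kappa> d D" and l: "l \<in> {1..\<kappa>}"
    and Rl: "R l \<in> carrier_mat (d l) (d l)"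
  shows "op_combination G (d l) (D l) (irrep_expansion \<kappa> d D R) = R l"
proof (rule eq_matI)
  fix p q assume "p < dim_row (R l)" "q < dim_col (R l)"
  then have pq: "p < d l" "q < d l" using Rl by auto
  let ?w = "\<lambda>l'. of_nat (d l') / of_nat (Coset.order G) :: complex"
  have "op_combination G (d l) (D l) (irrep_expansion \<kappa> d D R) $$ (p, q)
      = (\<Sum>f\<in>carrier G. \<Sum>l'=1..\<kappa>. \<Sum>j<d l'. \<Sum>k<d l'.
          ?w l' * R l' $$ (j, k) * (D l f $$ (p, q) * cnj (D l' f $$ (j, k))))"
    using pq by (simp add: index_op_combination irrep_expansion_def sum_distrib_left sum_distrib_right mult_ac)
  also have "\<dots> = (\<Sum>l'=1..\<kappa>. \<Sum>j<d l'. \<Sum>k<d l'. \<Sum>f\<in>carrier G.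
          ?w l' * R l' $$ (j, k) * (D l f $$ (p, q) * cnj (D l' f $$ (j, k))))"
    by (simp only: sum.swap[of _ _ "carrier G"])
  also have "\<dots> = (\<Sum>l'=1..\<kappa>. \<Sum>j<d l'. \<Sum>k<d l'.
          if l' = l then if j = p then if k = q then R l $$ (p, q) else 0 else 0 else 0)"
  proof (intro sum.cong refl)
    fix l' j k assume l': "l' \<in> {1..\<kappa>}" and jk: "j \<in> {..<d l'}" "k \<in> {..<d l'}"
    have "(\<Sum>f\<in>carrier G. ?w l' * R l' $$ (j, k) * (D l f $$ (p, q) * cnj (D l' f $$ (j, k))))
       = ?w l' * R l' $$ (j, k) * (if l = l' \<and> p = j \<and> q = k then of_nat (Coset.order G) / of_nat (d l) else 0)"
      unfolding sum_distrib_left[symmetric] using schur_orthogonality[OF complete l l' pq, of j k] jk by simp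
    also have "\<dots> = (if l' = l then if j = p then if k = q then R l $$ (p, q) else 0 else 0 else 0)"
      using order_pos pq by auto
    finally show "(\<Sum>f\<in>carrier G. ?w l' * R l' $$ (j, k) * (D l f $$ (p, q) * cnj (D l' f $$ (j, k)))) = \<dots>" .
  qed
  also have "\<dots> = (\<Sum>l'=1..\<kappa>. if l' = l then R l $$ (p, q) else 0)"
  proof (intro sum.cong refl)
    fix l' assume "l' \<in> {1..\<kappa>}"
    have "(\<Sum>j<d l'. \<Sum>k<d l'. if l' = l then if j = p then if k = q then R l $$ (p, q) else 0 else 0 else 0)
       = (\<Sum>j<d l'. if j = p then (if l' = l then R l $$ (p, q) else 0) else 0)"
      using pq by (intro sum.cong refl) auto
    then show "(\<Sum>j<d l'. \<Sum>k<d l'. if l' = l then if j = p then if k = q then R l $$ (p, q) else 0 else 0 else 0)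
       = (if l' = l then R l $$ (p, q) else 0)" using pq by auto
  qed
  also have "\<dots> = R l $$ (p, q)" using l by simp
  finally show "op_combination G (d l) (D l) (irrep_expansion \<kappa> d D R) $$ (p, q) = R l $$ (p, q)" .
qed (use Rl in auto)

lemma op_combination_eq_iff:
  "op_combination G n E c = op_combination G n E c' \<longleftrightarrow> op_combination G n E (\<lambda>f. c f - c' f) = 0\<^sub>m n n"
proof
  assume "op_combination G n E (\<lambda>f. c f - c' f) = 0\<^sub>m n n"
  then have *: "(op_combination G n E c - op_combination G n E c') $$ (i, j) = 0" if "i < n" "j < n" for i j
    using that by (simp add: op_combination_diff)
  have "op_combination G n E c $$ (i, j) = op_combination G n E c' $$ (i, j)" if "i < n" "j < n" for i j
    using *[OF that] that by simp
  then show "op_combination G n E c = op_combination G n E c'" by (intro eq_matI) simp_all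
next
  assume "op_combination G n E c = op_combination G n E c'"
  then show "op_combination G n E (\<lambda>f. c f - c' f) = 0\<^sub>m n n"
    unfolding op_combination_diff by (intro eq_matI) simp_all
qed

section \<open>Cocycle identity and normalisation of the factor system\<close>

lemma smult_unitary_cancel:
  assumes M: "M \<in> carrier_mat n n" "mat_adjoint M * M = 1\<^sub>m n" and n: "n > 0"
    and eq: "a \<cdot>\<^sub>m M = b \<cdot>\<^sub>m M"
  shows "a = (b :: complex)"
proof -
  have "a \<cdot>\<^sub>m 1\<^sub>m n = b \<cdot>\<^sub>m (1\<^sub>m n :: complex mat)"
    using arg_cong[OF eq, of "(*) (mat_adjoint M)"] M
      mult_smult_distrib[OF mat_adjoint_carrier[OF M(1)] M(1)] by simp
  from arg_cong[OF this, of "\<lambda>A. A $$ (0, 0)"] show ?thesis using n by simp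
qed

text \<open>Both sides are the scalar relating \<open>E g * E h * E k\<close> to the operator at the
  product. Positive dimension lets scalars be read off from a matrix identity.\<close>

lemma factor_system_cocycle:
  assumes E: "proj_unitary_rep G n \<gamma> E" and n: "n > 0"
    and g: "g \<in> carrier G" and h: "h \<in> carrier G" and k: "k \<in> carrier G"
  shows "\<gamma> g h * \<gamma> (g \<otimes> h) k = \<gamma> g (h \<otimes> k) * \<gamma> h k"
proof -
  note R = proj_unitary_repD[OF E]
  have gh: "g \<otimes> h \<in> carrier G" and hk: "h \<otimes> k \<in> carrier G" and ghk: "g \<otimes> (h \<otimes> k) \<in> carrier G"
    using g h k by auto
  have "(\<gamma> g h * \<gamma> (g \<otimes> h) k) \<cdot>\<^sub>m E (g \<otimes> (h \<otimes> k)) = \<gamma> g h \<cdot>\<^sub>m (E (g \<otimes> h) * E k)"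
    unfolding R(8)[OF gh k] using g h k by (auto simp: m_assoc mult.assoc intro!: eq_matI)
  also have "\<dots> = E g * E h * E k"
    unfolding R(8)[OF g h] by (rule mult_smult_assoc_mat[OF R(1)[OF gh] R(1)[OF k], symmetric])
  also have "\<dots> = E g * (E h * E k)"
    by (rule assoc_mult_mat[OF R(1)[OF g] R(1)[OF h] R(1)[OF k]])
  also have "\<dots> = \<gamma> h k \<cdot>\<^sub>m (E g * E (h \<otimes> k))"
    unfolding R(8)[OF h k] by (rule mult_smult_distrib[OF R(1)[OF g] R(1)[OF hk]])
  also have "\<dots> = (\<gamma> g (h \<otimes> k) * \<gamma> h k) \<cdot>\<^sub>m E (g \<otimes> (h \<otimes> k))"
    unfolding R(8)[OF g hk] by (auto simp: mult_ac intro!: eq_matI)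
  finally show ?thesis by (rule smult_unitary_cancel[OF R(1,4)[OF ghk] n])
qed

lemma factor_system_one:
  assumes E: "proj_unitary_rep G n \<gamma> E" and n: "n > 0" and one: "E \<one> = 1\<^sub>m n" and g: "g \<in> carrier G"
  shows "\<gamma> g \<one> = 1"
proof -
  note R = proj_unitary_repD[OF E]
  have "\<gamma> g \<one> \<cdot>\<^sub>m E g = 1 \<cdot>\<^sub>m E g"
    using R(8)[OF g one_closed] R(1)[OF g] g by (auto simp: one intro!: eq_matI)
  then show ?thesis by (rule smult_unitary_cancel[OF R(1,4)[OF g] n])
qed

text \<open>A unitary idempotent is the identity. The normalisation of one representation thereby
  passes, through \<open>\<gamma>\<close>, to the irreducibles and to the regular
  representation.\<close>

lemma proj_unitary_rep_one:
  assumes E: "proj_unitary_rep G n \<gamma> E" and "\<gamma> \<one> \<one> = 1"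
  shows "E \<one> = 1\<^sub>m n"
proof -
  note R = proj_unitary_repD[OF E one_closed]
  have "E \<one> * E \<one> = E \<one>" using R(8)[OF one_closed] assms(2) R(2,3) by (auto intro!: eq_matI)
  then have "mat_adjoint (E \<one>) * E \<one> * E \<one> = mat_adjoint (E \<one>) * E \<one>"
    using assoc_mult_mat[OF R(6) R(1) R(1)] by simp
  then show ?thesis unfolding R(4) using R(1) by simp
qed

subsection \<open>The twisted regular representation\<close>

text \<open>An arbitrary numbering of the group: representations are matrices indexed by naturals,
  whereas the operator \<open>C\<close> is a family indexed by group elements.\<close>

definition enum :: "nat \<Rightarrow> 'a" where
  "enum = (SOME e. bij_betw e {..<Coset.order G} (carrier G))"

lemma bij_betw_enum: "bij_betw enum {..<Coset.order G} (carrier G)"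
proof -
  have "\<exists>e. bij_betw e {..<Coset.order G} (carrier G)"
    using ex_bij_betw_nat_finite[OF finite_carrier] by (simp add: Coset.order_def atLeast0LessThan)
  then show ?thesis unfolding enum_def by (rule someI_ex)
qed

lemma enum_carrier [simp]: "i < Coset.order G \<Longrightarrow> enum i \<in> carrier G"
  using bij_betw_enum by (auto simp: bij_betw_def)

lemma enum_eq_iff: "i < Coset.order G \<Longrightarrow> j < Coset.order G \<Longrightarrow> enum i = enum j \<longleftrightarrow> i = j"
  using bij_betw_enum by (auto simp: bij_betw_def inj_on_def)

lemma enum_surj: "g \<in> carrier G \<Longrightarrow> \<exists>i<Coset.order G. enum i = g"
  using bij_betw_imp_surj_on[OF bij_betw_enum] by (metis imageE lessThan_iff)

lemma sum_enum: "(\<Sum>i<Coset.order G. h (enum i)) = (\<Sum>g\<in>carrier G. h g)"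
  by (rule sum.reindex_bij_betw[OF bij_betw_enum])

definition group_mat :: "('a \<Rightarrow> 'a \<Rightarrow> complex) \<Rightarrow> complex mat" where
  "group_mat K = mat (Coset.order G) (Coset.order G) (\<lambda>(i, j). K (enum i) (enum j))"

lemma group_mat_carrier [simp]: "group_mat K \<in> carrier_mat (Coset.order G) (Coset.order G)"
  by (simp add: group_mat_def)

lemma group_mat_eq_iff:
  "group_mat K = group_mat K' \<longleftrightarrow> (\<forall>g\<in>carrier G. \<forall>f\<in>carrier G. K g f = K' g f)"
proof
  assume eq: "group_mat K = group_mat K'"
  show "\<forall>g\<in>carrier G. \<forall>f\<in>carrier G. K g f = K' g f"
  proof (intro ballI)
    fix g f assume "g \<in> carrier G" "f \<in> carrier G"
    then obtain i j where "i < Coset.order G" "enum i = g" "j < Coset.order G" "enum j = f"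
      using enum_surj by blast
    then show "K g f = K' g f"
      using arg_cong[OF eq, of "\<lambda>A. A $$ (i, j)"] by (simp add: group_mat_def)
  qed
next
  assume "\<forall>g\<in>carrier G. \<forall>f\<in>carrier G. K g f = K' g f"
  then show "group_mat K = group_mat K'" by (intro eq_matI) (auto simp: group_mat_def)
qed

lemma group_mat_one: "1\<^sub>m (Coset.order G) = group_mat (\<lambda>g f. if g = f then 1 else 0)"
  by (intro eq_matI) (auto simp: group_mat_def enum_eq_iff)

lemma mat_adjoint_group_mat: "mat_adjoint (group_mat K) = group_mat (\<lambda>g f. cnj (K f g))"
  by (intro eq_matI) (auto simp: group_mat_def)

lemma group_mat_mult:
  "group_mat K * group_mat K' = group_mat (\<lambda>g f. \<Sum>k\<in>carrier G. K g k * K' k f)"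
proof (rule eq_matI)
  fix i j
  assume "i < dim_row (group_mat (\<lambda>g f. \<Sum>k\<in>carrier G. K g k * K' k f))"
    "j < dim_col (group_mat (\<lambda>g f. \<Sum>k\<in>carrier G. K g k * K' k f))"
  then have ij: "i < Coset.order G" "j < Coset.order G" by (auto simp: group_mat_def)
  have "(group_mat K * group_mat K') $$ (i, j)
      = (\<Sum>l<Coset.order G. K (enum i) (enum l) * K' (enum l) (enum j))"
    unfolding index_mult_mat_sum[OF group_mat_carrier group_mat_carrier ij]
    using ij by (intro sum.cong) (auto simp: group_mat_def)
  also have "\<dots> = (\<Sum>k\<in>carrier G. K (enum i) k * K' k (enum j))" by (rule sum_enum)
  finally show "(group_mat K * group_mat K') $$ (i, j)
      = group_mat (\<lambda>g f. \<Sum>k\<in>carrier G. K g k * K' k f) $$ (i, j)"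
    using ij by (simp add: group_mat_def)
qed (auto simp: group_mat_def)

lemma unitary_on_iff_group_mat:
  "unitary_on (carrier G) K \<longleftrightarrow> unitary_mat (Coset.order G) (group_mat K)"
  unfolding unitary_on_def unitary_mat_def mat_adjoint_group_mat group_mat_mult group_mat_one group_mat_eq_iff
  by simp

text \<open>Row \<open>g\<close> has its only entry \<open>\<gamma> g h\<close> in column
  \<open>g \<otimes> h\<close>, that is, right translation by \<open>h\<close> on bras. With this
  choice the combination with coefficients \<open>c\<close> is exactly \<open>C\<close>.\<close>

definition regular_rep :: "('a \<Rightarrow> 'a \<Rightarrow> complex) \<Rightarrow> 'a \<Rightarrow> complex mat" where
  "regular_rep \<gamma> h = group_mat (\<lambda>g f. if f = g \<otimes> h then \<gamma> g h else 0)"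

text \<open>The rows are orthonormal because right translation is injective and the phases have
  modulus 1; the product law is the cocycle identity. \<open>E\<close> supplies these two properties
  of \<open>\<gamma>\<close>.\<close>

lemma proj_unitary_rep_regular:
  assumes E: "proj_unitary_rep G n \<gamma> E" and n: "n > 0"
  shows "proj_unitary_rep G (Coset.order G) \<gamma> (regular_rep \<gamma>)"
  unfolding proj_unitary_rep_def
proof (intro ballI conjI)
  note R = proj_unitary_repD[OF E]
  fix h assume h: "h \<in> carrier G"
  have "regular_rep \<gamma> h * mat_adjoint (regular_rep \<gamma> h) = 1\<^sub>m (Coset.order G)"
    unfolding regular_rep_def mat_adjoint_group_mat group_mat_mult group_mat_one group_mat_eq_iff
  proof (intro ballI)
    fix g f assume g: "g \<in> carrier G" and f: "f \<in> carrier G"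
    have "(\<Sum>k\<in>carrier G. (if k = g \<otimes> h then \<gamma> g h else 0) * cnj (if k = f \<otimes> h then \<gamma> f h else 0))
      = (\<Sum>k\<in>carrier G. if k = g \<otimes> h then (if g = f then \<gamma> g h * cnj (\<gamma> g h) else 0) else 0)"
      using g f h by (intro sum.cong) auto
    also have "\<dots> = (if g = f then 1 else 0)"
      using g h finite_carrier cnj_mult_self_cmod_1[OF R(7)[OF g h]] by (cases "g = f") (simp_all add: mult.commute)
    finally show "(\<Sum>k\<in>carrier G. (if k = g \<otimes> h then \<gamma> g h else 0) * cnj (if k = f \<otimes> h then \<gamma> f h else 0))
      = (if g = f then 1 else 0)" .
  qed
  moreover have "regular_rep \<gamma> h \<in> carrier_mat (Coset.order G) (Coset.order G)"
    by (simp add: regular_rep_def)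
  ultimately show "unitary_mat (Coset.order G) (regular_rep \<gamma> h)"
    unfolding unitary_mat_def using mat_mult_left_right_inverse mat_adjoint_carrier by blast
next
  note R = proj_unitary_repD[OF E]
  fix h k assume h: "h \<in> carrier G" and k: "k \<in> carrier G"
  show "cmod (\<gamma> h k) = 1" by (rule R(7)[OF h k])
  have smult: "a \<cdot>\<^sub>m group_mat K = group_mat (\<lambda>g f. a * K g f)" for a K
    by (intro eq_matI) (auto simp: group_mat_def)
  show "regular_rep \<gamma> h * regular_rep \<gamma> k = \<gamma> h k \<cdot>\<^sub>m regular_rep \<gamma> (h \<otimes> k)"
    unfolding regular_rep_def smult group_mat_mult group_mat_eq_iff
  proof (intro ballI)
    fix g f assume g: "g \<in> carrier G" and f: "f \<in> carrier G"
    have "(\<Sum>l\<in>carrier G. (if l = g \<otimes> h then \<gamma> g h else 0) * (if f = l \<otimes> k then \<gamma> l k else 0))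
      = (\<Sum>l\<in>carrier G. if l = g \<otimes> h then (if f = g \<otimes> h \<otimes> k then \<gamma> g h * \<gamma> (g \<otimes> h) k else 0) else 0)"
      by (intro sum.cong) auto
    also have "\<dots> = (if f = g \<otimes> h \<otimes> k then \<gamma> g h * \<gamma> (g \<otimes> h) k else 0)"
      using g h finite_carrier by simp
    also have "\<dots> = \<gamma> h k * (if f = g \<otimes> (h \<otimes> k) then \<gamma> g (h \<otimes> k) else 0)"
      using g h k factor_system_cocycle[OF E n g h k] by (simp add: m_assoc mult.commute)
    finally show "(\<Sum>l\<in>carrier G. (if l = g \<otimes> h then \<gamma> g h else 0) * (if f = l \<otimes> k then \<gamma> l k else 0))
      = \<gamma> h k * (if f = g \<otimes> (h \<otimes> k) then \<gamma> g (h \<otimes> k) else 0)" .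
  qed
qed

lemma op_combination_regular:
  "op_combination G (Coset.order G) (regular_rep \<gamma>) c = group_mat (coeff_operator G \<gamma> c)"
proof (rule eq_matI)
  fix i j
  assume "i < dim_row (group_mat (coeff_operator G \<gamma> c))" "j < dim_col (group_mat (coeff_operator G \<gamma> c))"
  then have ij: "i < Coset.order G" "j < Coset.order G" by (auto simp: group_mat_def)
  define g f where "g = enum i" and "f = enum j"
  have g: "g \<in> carrier G" and f: "f \<in> carrier G" using ij by (auto simp: g_def f_def)
  have "op_combination G (Coset.order G) (regular_rep \<gamma>) c $$ (i, j)
    = (\<Sum>h\<in>carrier G. c h * (if f = g \<otimes> h then \<gamma> g h else 0))"
    using ij unfolding g_def f_def by (simp add: index_op_combination regular_rep_def group_mat_def)
  also have "\<dots> = (\<Sum>h\<in>carrier G. if h = inv g \<otimes> f then coeff_operator G \<gamma> c g f else 0)"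
  proof (intro sum.cong refl)
    fix h assume h: "h \<in> carrier G"
    have "f = g \<otimes> h \<longleftrightarrow> h = inv g \<otimes> f" using g f h by (metis inv_solve_left)
    then show "c h * (if f = g \<otimes> h then \<gamma> g h else 0) = (if h = inv g \<otimes> f then coeff_operator G \<gamma> c g f else 0)"
      by (auto simp: coeff_operator_def)
  qed
  also have "\<dots> = coeff_operator G \<gamma> c g f" using g f finite_carrier by simp
  finally show "op_combination G (Coset.order G) (regular_rep \<gamma>) c $$ (i, j) = group_mat (coeff_operator G \<gamma> c) $$ (i, j)"
    using ij by (simp add: group_mat_def g_def f_def)
qed (auto simp: group_mat_def)

text \<open>The row at the identity of the group lists \<open>c f\<close> up to the nonzero phases
  \<open>\<gamma> \<one> f\<close>.\<close>

lemma regular_rep_faithful: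
  assumes E: "proj_unitary_rep G n \<gamma> E"
    and eq: "op_combination G (Coset.order G) (regular_rep \<gamma>) c = op_combination G (Coset.order G) (regular_rep \<gamma>) c'"
    and f: "f \<in> carrier G"
  shows "c f = c' f"
proof -
  have "coeff_operator G \<gamma> c \<one> f = coeff_operator G \<gamma> c' \<one> f"
    using eq f unfolding op_combination_regular group_mat_eq_iff by blast
  moreover have "\<gamma> \<one> f \<noteq> 0" using proj_unitary_repD(7)[OF E one_closed f] by auto
  ultimately show ?thesis using f by (simp add: coeff_operator_def)
qed

text \<open>Injectivity of the Fourier transform: apply the vanishing criterion to
  \<open>c - c'\<close> on the regular representation, always through its first alternative, and
  conclude by faithfulness.\<close>

lemma eq_if_irreps_eq:
  assumes E: "proj_unitary_rep G n \<gamma> E" and n: "n > 0" and complete: "complete_irreps G \<gamma> \<kappa> d D"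
    and eq: "\<And>l. l \<in> {1..\<kappa>} \<Longrightarrow> op_combination G (d l) (D l) c = op_combination G (d l) (D l) c'"
    and f: "f \<in> carrier G"
  shows "c f = c' f"
proof -
  have "op_combination G (Coset.order G) (regular_rep \<gamma>) (\<lambda>f. c f - c' f) = 0\<^sub>m (Coset.order G) (Coset.order G)"
    using eq op_combination_eq_iff
    by (intro op_combination_eq_0_of_irreps[OF complete proj_unitary_rep_regular[OF E n]]) blast
  then show ?thesis using regular_rep_faithful[OF E _ f] op_combination_eq_iff by blast
qed

section \<open>The three conditions on the coefficients\<close>

lemma complete_irrepsD:
  assumes "complete_irreps G \<gamma> \<kappa> d D" "l \<in> {1..\<kappa>}"
  shows "proj_unitary_rep G (d l) \<gamma> (D l)" "irreducible_rep G (d l) (D l)"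
  using assms unfolding complete_irreps_def by auto

lemma unitary_coeff_operator_iff:
  assumes E: "proj_unitary_rep G n \<gamma> E" and n: "n > 0" and one: "E \<one> = 1\<^sub>m n"
  shows "unitary_coeff_operator G \<gamma> c \<longleftrightarrow> orthonormal_coeffs G \<gamma> c"
proof -
  let ?L = "op_combination G (Coset.order G) (regular_rep \<gamma>)"
  note reg = proj_unitary_rep_regular[OF E n]
  have "regular_rep \<gamma> \<one> = 1\<^sub>m (Coset.order G)"
    by (rule proj_unitary_rep_one[OF reg factor_system_one[OF E n one one_closed]])
  then have delta: "?L (\<lambda>g. if g = \<one> then 1 else 0) = 1\<^sub>m (Coset.order G)"
    by (rule op_combination_delta_one)
  have "unitary_coeff_operator G \<gamma> c \<longleftrightarrow> ?L (correlation \<gamma> c) = ?L (\<lambda>g. if g = \<one> then 1 else 0)"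
    unfolding unitary_coeff_operator_def unitary_on_iff_group_mat op_combination_regular[symmetric] delta
    by (rule unitary_mat_op_combination_iff[OF reg])
  also have "\<dots> \<longleftrightarrow> orthonormal_coeffs G \<gamma> c"
  proof
    assume eq: "?L (correlation \<gamma> c) = ?L (\<lambda>g. if g = \<one> then 1 else 0)"
    show "orthonormal_coeffs G \<gamma> c"
      unfolding orthonormal_coeffs_iff by (intro ballI regular_rep_faithful[OF E eq])
  next
    assume "orthonormal_coeffs G \<gamma> c"
    then show "?L (correlation \<gamma> c) = ?L (\<lambda>g. if g = \<one> then 1 else 0)"
      unfolding orthonormal_coeffs_iff by (intro op_combination_cong) simp
  qed
  finally show ?thesis .
qed

lemma orthonormal_coeffs_imp_unitary:
  assumes E: "proj_unitary_rep G n \<gamma> E" and one: "E \<one> = 1\<^sub>m n" and c: "orthonormal_coeffs G \<gamma> c"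
  shows "unitary_mat n (op_combination G n E c)"
proof -
  have "op_combination G n E (correlation \<gamma> c) = op_combination G n E (\<lambda>g. if g = \<one> then 1 else 0)"
    using c unfolding orthonormal_coeffs_iff by (intro op_combination_cong) simp
  then show ?thesis
    unfolding unitary_mat_op_combination_iff[OF E] op_combination_delta_one[where E = E, OF one] .
qed

text \<open>Unitarity on each irreducible says that \<open>correlation \<gamma> c\<close> and the
  delta at the identity have equal Fourier transforms, hence are equal.\<close>

lemma orthonormal_coeffs_iff_unitary_irreps:
  assumes E: "proj_unitary_rep G n \<gamma> E" and n: "n > 0" and one: "E \<one> = 1\<^sub>m n"
    and complete: "complete_irreps G \<gamma> \<kappa> d D"
  shows "orthonormal_coeffs G \<gamma> c \<longleftrightarrow> (\<forall>l\<in>{1..\<kappa>}. unitary_mat (d l) (op_combination G (d l) (D l) c))"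
proof
  have D1: "D l \<one> = 1\<^sub>m (d l)" if "l \<in> {1..\<kappa>}" for l
    by (rule proj_unitary_rep_one[OF complete_irrepsD(1)[OF complete that] factor_system_one[OF E n one one_closed]])
  show "\<forall>l\<in>{1..\<kappa>}. unitary_mat (d l) (op_combination G (d l) (D l) c)" if "orthonormal_coeffs G \<gamma> c"
  proof
    fix l assume l: "l \<in> {1..\<kappa>}"
    show "unitary_mat (d l) (op_combination G (d l) (D l) c)"
      by (rule orthonormal_coeffs_imp_unitary[where E = "D l", OF complete_irrepsD(1)[OF complete l] D1[OF l] that])
  qed
  assume unit: "\<forall>l\<in>{1..\<kappa>}. unitary_mat (d l) (op_combination G (d l) (D l) c)"
  have "op_combination G (d l) (D l) (correlation \<gamma> c)
      = op_combination G (d l) (D l) (\<lambda>g. if g = \<one> then 1 else 0)" if l: "l \<in> {1..\<kappa>}" for l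
    using bspec[OF unit l]
    unfolding unitary_mat_op_combination_iff[OF complete_irrepsD(1)[OF complete l]]
      op_combination_delta_one[where E = "D l", OF D1[OF l]] .
  then show "orthonormal_coeffs G \<gamma> c"
    unfolding orthonormal_coeffs_iff by (intro ballI eq_if_irreps_eq[OF E n complete])
qed

text \<open>The inversion formula identifies \<open>R l\<close> with the combination of
  \<open>c\<close> on \<open>D l\<close>. Conversely, expanding with these combinations as
  \<open>R\<close> gives a function with the same Fourier transform as \<open>c\<close>.\<close>

lemma unitary_irrep_expansion_iff:
  assumes E: "proj_unitary_rep G n \<gamma> E" and n: "n > 0" and complete: "complete_irreps G \<gamma> \<kappa> d D"
  shows "unitary_irrep_expansion G \<kappa> d D c \<longleftrightarrow> (\<forall>l\<in>{1..\<kappa>}. unitary_mat (d l) (op_combination G (d l) (D l) c))"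
proof
  assume "unitary_irrep_expansion G \<kappa> d D c"
  then obtain R where R: "\<And>l. l \<in> {1..\<kappa>} \<Longrightarrow> unitary_mat (d l) (R l)"
    and c: "\<And>f. f \<in> carrier G \<Longrightarrow> c f = irrep_expansion \<kappa> d D R f"
    unfolding unitary_irrep_expansion_def irrep_expansion_def by blast
  show "\<forall>l\<in>{1..\<kappa>}. unitary_mat (d l) (op_combination G (d l) (D l) c)"
  proof
    fix l assume l: "l \<in> {1..\<kappa>}"
    have "op_combination G (d l) (D l) c = op_combination G (d l) (D l) (irrep_expansion \<kappa> d D R)"
      by (rule op_combination_cong) (rule c)
    also have "\<dots> = R l"
      using R[OF l] by (intro op_combination_irrep_expansion[OF complete l]) (simp add: unitary_mat_def)
    finally show "unitary_mat (d l) (op_combination G (d l) (D l) c)" using R[OF l] by simp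
  qed
next
  assume unit: "\<forall>l\<in>{1..\<kappa>}. unitary_mat (d l) (op_combination G (d l) (D l) c)"
  define R where "R l = op_combination G (d l) (D l) c" for l
  have "c f = irrep_expansion \<kappa> d D R f" if "f \<in> carrier G" for f
    using that
    by (rule eq_if_irreps_eq[OF E n complete, rotated])
      (simp add: op_combination_irrep_expansion[OF complete] R_def)
  then show "unitary_irrep_expansion G \<kappa> d D c"
    using unit unfolding unitary_irrep_expansion_def irrep_expansion_def
    by (intro exI[of _ R] conjI ballI) (simp_all add: R_def)
qed

lemma exists_orthonormal_coeffs:
  assumes E: "proj_unitary_rep G n \<gamma> E" and n: "n > 0" and one: "E \<one> = 1\<^sub>m n"
    and complete: "complete_irreps G \<gamma> \<kappa> d D" and unit: "unitary_mat n (op_combination G n E c)"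
  obtains c' where "op_combination G n E c' = op_combination G n E c" "orthonormal_coeffs G \<gamma> c'"
proof -
  \<comment> \<open>Occurrence of \<open>D l\<close> in \<open>E\<close> is expressed by a nonzero
    intertwiner, matching the second alternative of the vanishing criterion, so no multiplicities
    are needed.\<close>
  define occurs where "occurs l \<longleftrightarrow>
    (\<exists>J\<in>carrier_mat n (d l). (\<forall>f\<in>carrier G. J * D l f = E f * J) \<and> J \<noteq> 0\<^sub>m n (d l))" for l
  define R where "R l = (if occurs l then op_combination G (d l) (D l) c else 1\<^sub>m (d l))" for l
  define c' where "c' = irrep_expansion \<kappa> d D R"
  have D1: "D l \<one> = 1\<^sub>m (d l)" if "l \<in> {1..\<kappa>}" for l
    by (rule proj_unitary_rep_one[OF complete_irrepsD(1)[OF complete that] factor_system_one[OF E n one one_closed]])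
  \<comment> \<open>The combination of \<open>?u\<close> vanishes on a representation exactly when
    that of \<open>c\<close> is unitary there.\<close>
  let ?u = "\<lambda>g. correlation \<gamma> c g - (if g = \<one> then 1 else 0)"
  have Eu: "op_combination G n E ?u = 0\<^sub>m n n"
    using unit unfolding unitary_mat_op_combination_iff[OF E] op_combination_eq_iff[symmetric]
      op_combination_delta_one[where E = E, OF one] .
  have Du: "unitary_mat (d l) (op_combination G (d l) (D l) c)" if l: "l \<in> {1..\<kappa>}" and occ: "occurs l" for l
  proof -
    note D = complete_irrepsD[OF complete l]
    obtain J where J: "J \<in> carrier_mat n (d l)" and JD: "\<And>f. f \<in> carrier G \<Longrightarrow> J * D l f = E f * J"
      and J0: "J \<noteq> 0\<^sub>m n (d l)"
      using occ unfolding occurs_def by blast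
    let ?Lu = "op_combination G (d l) (D l) ?u"
    obtain a where a: "mat_adjoint J * J = a \<cdot>\<^sub>m 1\<^sub>m (d l)"
      using intertwiner_adjoint_mult_scalar[OF E D J JD] by auto
    have "a \<noteq> 0"
    proof
      assume "a = 0"
      then have "mat_adjoint J * J = 0\<^sub>m (d l) (d l)" using a by (auto intro!: eq_matI)
      then show False using adjoint_mult_self_eq_0_imp[OF J] J0 by blast
    qed
    have "J * ?Lu = 0\<^sub>m n n * J"
      unfolding Eu[symmetric]
      by (rule op_combination_intertwine[OF J proj_unitary_repD(1)[OF E] proj_unitary_repD(1)[OF D(1)] JD])
    then have JL: "J * ?Lu = 0\<^sub>m n (d l)" using J by simp
    \<comment> \<open>A nonzero intertwiner pulls the vanishing of \<open>?u\<close> on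
      \<open>E\<close> back to \<open>D l\<close>: \<open>J * ?Lu = 0\<close>, and \<open>J\<close>
      is cancelled because \<open>J\<^sup>\<dagger> J\<close> is a nonzero scalar.\<close>
    have "a \<cdot>\<^sub>m ?Lu = mat_adjoint J * J * ?Lu"
      unfolding a using mult_smult_assoc_mat[OF one_carrier_mat op_combination_carrier] by simp
    also have "\<dots> = mat_adjoint J * (J * ?Lu)"
      by (rule assoc_mult_mat[OF mat_adjoint_carrier[OF J] J op_combination_carrier])
    also have "\<dots> = 0\<^sub>m (d l) (d l)" unfolding JL using J by simp
    finally have aL: "a \<cdot>\<^sub>m ?Lu = 0\<^sub>m (d l) (d l)" .
    have "?Lu = 0\<^sub>m (d l) (d l)"
    proof (rule eq_matI)
      fix i j assume "i < dim_row (0\<^sub>m (d l) (d l) :: complex mat)" "j < dim_col (0\<^sub>m (d l) (d l) :: complex mat)"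
      then have ij: "i < d l" "j < d l" by auto
      then show "?Lu $$ (i, j) = 0\<^sub>m (d l) (d l) $$ (i, j)"
        using arg_cong[OF aL, of "\<lambda>A. A $$ (i, j)"] \<open>a \<noteq> 0\<close> by simp
    qed auto
    then show ?thesis
      unfolding unitary_mat_op_combination_iff[OF D(1)] op_combination_eq_iff[symmetric]
        op_combination_delta_one[where E = "D l", OF D1[OF l]] .
  qed
  have c'R: "op_combination G (d l) (D l) c' = R l" if "l \<in> {1..\<kappa>}" for l
    unfolding c'_def by (rule op_combination_irrep_expansion[OF complete that]) (simp add: R_def)
  have "unitary_mat (d l) (R l)" if "l \<in> {1..\<kappa>}" for l
    using Du[OF that] by (simp add: R_def unitary_mat_def)
  then have "orthonormal_coeffs G \<gamma> c'"
    unfolding orthonormal_coeffs_iff_unitary_irreps[OF E n one complete] using c'R by simp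
  \<comment> \<open>On occurring irreducibles \<open>c'\<close> and \<open>c\<close> have the same
    Fourier transform; the others meet the second alternative, so the change made there is invisible
    on \<open>E\<close>.\<close>
  moreover have "op_combination G n E (\<lambda>f. c' f - c f) = 0\<^sub>m n n"
  proof (rule op_combination_eq_0_of_irreps[OF complete E])
    fix l assume l: "l \<in> {1..\<kappa>}"
    show "op_combination G (d l) (D l) (\<lambda>f. c' f - c f) = 0\<^sub>m (d l) (d l) \<or>
      (\<forall>J\<in>carrier_mat n (d l). (\<forall>f\<in>carrier G. J * D l f = E f * J) \<longrightarrow> J = 0\<^sub>m n (d l))"
    proof (cases "occurs l")
      case True
      then show ?thesis using c'R[OF l] op_combination_eq_iff unfolding R_def by metis
    next
      case False
      then show ?thesis unfolding occurs_def by blast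
    qed
  qed
  ultimately show thesis using that op_combination_eq_iff by blast
qed

subsection \<open>The double-unitary protocol\<close>

lemma proj_unitary_rep_kronecker:
  assumes U: "proj_unitary_rep G n \<mu> U" and V: "proj_unitary_rep G m \<nu> V"
  shows "proj_unitary_rep G (n * m) (\<lambda>f g. \<mu> f g * \<nu> f g) (\<lambda>f. kronecker (U f) (V f))"
  unfolding proj_unitary_rep_def
proof (intro ballI conjI)
  note RU = proj_unitary_repD[OF U] and RV = proj_unitary_repD[OF V]
  show "unitary_mat (n * m) (kronecker (U f) (V f))" if "f \<in> carrier G" for f
    using unitary_mat_kronecker U V that unfolding proj_unitary_rep_def by blast
  fix f g assume f: "f \<in> carrier G" and g: "g \<in> carrier G"
  show "cmod (\<mu> f g * \<nu> f g) = 1" using RU(7)[OF f g] RV(7)[OF f g] by (simp add: norm_mult)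
  show "kronecker (U f) (V f) * kronecker (U g) (V g) = (\<mu> f g * \<nu> f g) \<cdot>\<^sub>m kronecker (U (f \<otimes> g)) (V (f \<otimes> g))"
    unfolding kronecker_mult[OF RU(1)[OF f] RV(1)[OF f] RU(1)[OF g] RV(1)[OF g]] RU(8)[OF f g] RV(8)[OF f g]
    by (rule kronecker_smult)
qed

lemma op_combination_mult_vec:
  assumes E: "\<And>f. f \<in> carrier G \<Longrightarrow> E f \<in> carrier_mat n n" and v: "v \<in> carrier_vec n"
  shows "finsum_vec TYPE(complex) n (\<lambda>f. a f \<cdot>\<^sub>v (E f *\<^sub>v v)) (carrier G) = op_combination G n E a *\<^sub>v v"
proof (rule eq_vecI)
  have c: "(\<lambda>f. a f \<cdot>\<^sub>v (E f *\<^sub>v v)) \<in> carrier G \<rightarrow> carrier_vec n"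
    using mult_mat_vec_carrier[OF E v] by simp
  show "dim_vec (finsum_vec TYPE(complex) n (\<lambda>f. a f \<cdot>\<^sub>v (E f *\<^sub>v v)) (carrier G)) = dim_vec (op_combination G n E a *\<^sub>v v)"
    using finsum_vec_closed[OF c] by auto
  fix i assume "i < dim_vec (op_combination G n E a *\<^sub>v v)"
  then have i: "i < n" by simp
  have "finsum_vec TYPE(complex) n (\<lambda>f. a f \<cdot>\<^sub>v (E f *\<^sub>v v)) (carrier G) $ i
      = (\<Sum>f\<in>carrier G. (a f \<cdot>\<^sub>v (E f *\<^sub>v v)) $ i)"
    by (rule index_finsum_vec[OF finite_carrier i c])
  also have "\<dots> = (\<Sum>f\<in>carrier G. \<Sum>l<n. a f * E f $$ (i, l) * v $ l)"
  proof (rule sum.cong[OF refl])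
    fix f assume f: "f \<in> carrier G"
    show "(a f \<cdot>\<^sub>v (E f *\<^sub>v v)) $ i = (\<Sum>l<n. a f * E f $$ (i, l) * v $ l)"
      using index_mult_mat_vec_sum[OF E[OF f] v i] carrier_matD[OF E[OF f]] i
      by (simp add: sum_distrib_left mult.assoc del: index_mult_mat_vec)
  qed
  also have "\<dots> = (\<Sum>l<n. (\<Sum>f\<in>carrier G. a f * E f $$ (i, l)) * v $ l)"
    unfolding sum_distrib_right by (rule sum.swap)
  also have "\<dots> = (op_combination G n E a *\<^sub>v v) $ i"
    unfolding index_mult_mat_vec_sum[OF op_combination_carrier v i]
    using i by (intro sum.cong) (auto simp: index_op_combination)
  finally show "finsum_vec TYPE(complex) n (\<lambda>f. a f \<cdot>\<^sub>v (E f *\<^sub>v v)) (carrier G) $ i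
      = (op_combination G n E a *\<^sub>v v) $ i" .
qed

text \<open>Put \<open>f = g \<otimes> k\<close>: row \<open>g\<close> of \<open>C\<close>
  contributes \<open>\<gamma> g k * c k\<close>, and \<open>E(g)\<^sup>\<dagger> E(gk)\<close>
  contributes the conjugate phase. Hence the corrections after outcome \<open>g\<close> restore the
  same operator for every \<open>g\<close>.\<close>

lemma adjoint_mult_coeff_row:
  assumes E: "proj_unitary_rep G n \<gamma> E" and g: "g \<in> carrier G"
  shows "mat_adjoint (E g) * op_combination G n E (coeff_operator G \<gamma> c g) = op_combination G n E c"
proof (rule eq_matI)
  note R = proj_unitary_repD[OF E]
  fix i j assume "i < dim_row (op_combination G n E c)" "j < dim_col (op_combination G n E c)"
  then have ij: "i < n" "j < n" by auto
  have "(mat_adjoint (E g) * op_combination G n E (coeff_operator G \<gamma> c g)) $$ (i, j)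
      = (\<Sum>f\<in>carrier G. coeff_operator G \<gamma> c g f * (mat_adjoint (E g) * E f) $$ (i, j))"
    by (rule index_mult_op_combination[OF R(6)[OF g] R(1) ij])
  also have "\<dots> = (\<Sum>k\<in>carrier G. coeff_operator G \<gamma> c g (g \<otimes> k) * (mat_adjoint (E g) * E (g \<otimes> k)) $$ (i, j))"
    by (rule sum_translate[OF g, symmetric])
  also have "\<dots> = (\<Sum>k\<in>carrier G. c k * E k $$ (i, j))"
  proof (rule sum.cong[OF refl])
    fix k assume k: "k \<in> carrier G"
    have "inv g \<otimes> (g \<otimes> k) = k" using g k by (simp flip: m_assoc)
    then show "coeff_operator G \<gamma> c g (g \<otimes> k) * (mat_adjoint (E g) * E (g \<otimes> k)) $$ (i, j) = c k * E k $$ (i, j)"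
      using cnj_mult_self_cmod_1[OF R(7)[OF g k]] R(2,3)[OF k] ij
      by (simp add: coeff_operator_def proj_unitary_rep_adjoint_mult[OF E g k] mult_ac)
  qed
  finally show "(mat_adjoint (E g) * op_combination G n E (coeff_operator G \<gamma> c g)) $$ (i, j)
      = op_combination G n E c $$ (i, j)"
    using ij by (simp add: index_op_combination)
qed (use proj_unitary_repD(3)[OF E g] in auto)

lemma finsum_vec_cong:
  assumes "\<And>f. f \<in> carrier G \<Longrightarrow> v f = w f" "\<And>f. f \<in> carrier G \<Longrightarrow> w f \<in> carrier_vec n"
  shows "finsum_vec TYPE(complex) n v (carrier G) = finsum_vec TYPE(complex) n w (carrier G)"
  unfolding finsum_vec_def
  by (rule comm_monoid.finprod_cong'[OF comm_monoid_vec]) (use assms in \<open>auto simp: monoid_vec_simps\<close>)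

lemma finsum_vec_delta:
  assumes k: "k \<in> carrier G" and v: "v \<in> carrier_vec n"
  shows "finsum_vec TYPE(complex) n (\<lambda>f. a f \<cdot>\<^sub>v (if f = k then v else 0\<^sub>v n)) (carrier G) = a k \<cdot>\<^sub>v v"
proof (rule eq_vecI)
  have c: "(\<lambda>f. a f \<cdot>\<^sub>v (if f = k then v else 0\<^sub>v n)) \<in> carrier G \<rightarrow> carrier_vec n" using v by auto
  show "dim_vec (finsum_vec TYPE(complex) n (\<lambda>f. a f \<cdot>\<^sub>v (if f = k then v else 0\<^sub>v n)) (carrier G)) = dim_vec (a k \<cdot>\<^sub>v v)"
    using finsum_vec_closed[OF c] v by auto
  fix i assume "i < dim_vec (a k \<cdot>\<^sub>v v)"
  then have i: "i < n" using v by simp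
  have "finsum_vec TYPE(complex) n (\<lambda>f. a f \<cdot>\<^sub>v (if f = k then v else 0\<^sub>v n)) (carrier G) $ i
      = (\<Sum>f\<in>carrier G. (a f \<cdot>\<^sub>v (if f = k then v else 0\<^sub>v n)) $ i)"
    by (rule index_finsum_vec[OF finite_carrier i c])
  also have "\<dots> = (\<Sum>f\<in>carrier G. if f = k then (a k \<cdot>\<^sub>v v) $ i else 0)"
    using i by (intro sum.cong) auto
  also have "\<dots> = (a k \<cdot>\<^sub>v v) $ i" using k finite_carrier by simp
  finally show "finsum_vec TYPE(complex) n (\<lambda>f. a f \<cdot>\<^sub>v (if f = k then v else 0\<^sub>v n)) (carrier G) $ i
      = (a k \<cdot>\<^sub>v v) $ i" .
qed

text \<open>The diagonal initial state ties \<open>f\<close> on \<open>a\<close> to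
  \<open>f'\<close> on \<open>b\<close>, and \<open>Z(h)\<close> turns the outcome-dependent factor
  \<open>F h f'\<close> into the constant \<open>z\<close>. What remains is row \<open>g\<close> of
  \<open>C\<close> applied to the operators \<open>T f'\<close>. The squared modulus of the scalar
  is \<open>1/N\<^sup>2\<close>, the same for all \<open>N\<^sup>2\<close> pairs of
  outcomes.\<close>

lemma protocol_branch_eq:
  assumes U: "proj_unitary_rep G nA \<mu> U" and V: "proj_unitary_rep G nB \<nu> V"
    and F: "admissible_ancilla_gates G F z"
    and h: "h \<in> carrier G" and g: "g \<in> carrier G" and \<Psi>: "\<Psi> \<in> carrier_vec (nA * nB)"
  defines "\<gamma> \<equiv> \<lambda>f g. \<mu> f g * \<nu> f g" and "T \<equiv> \<lambda>f. kronecker (U f) (V f)"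
  shows "protocol_branch G nA nB U V F z (coeff_operator G \<gamma> c) h g \<Psi>
    = (z * complex_of_real (1 / sqrt (real (Coset.order G)))) \<cdot>\<^sub>v (op_combination G (nA * nB) T c *\<^sub>v \<Psi>)"
proof -
  define n where "n = nA * nB"
  define s where "s = complex_of_real (1 / sqrt (real (Coset.order G)))"
  define onA where "onA X = kronecker X (1\<^sub>m nB)" for X
  define onB where "onB Y = kronecker (1\<^sub>m nA) Y" for Y
  define vsum where "vsum v = finsum_vec TYPE(complex) n v (carrier G)" for v
  define C where "C = coeff_operator G \<gamma> c"
  note RU = proj_unitary_repD[OF U] and RV = proj_unitary_repD[OF V]
  have T: "proj_unitary_rep G n \<gamma> T" unfolding n_def \<gamma>_def T_def by (rule proj_unitary_rep_kronecker[OF U V])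
  note RT = proj_unitary_repD[OF T]
  have \<Psi>': "\<Psi> \<in> carrier_vec n" using \<Psi> by (simp add: n_def)
  have onA: "onA X \<in> carrier_mat n n" if "X \<in> carrier_mat nA nA" for X
    unfolding onA_def n_def using that by simp
  have onB: "onB Y \<in> carrier_mat n n" if "Y \<in> carrier_mat nB nB" for Y
    unfolding onB_def n_def using that by simp
  have onBA: "onB Y *\<^sub>v (onA X *\<^sub>v w) = kronecker X Y *\<^sub>v w" and onAB: "onA X *\<^sub>v (onB Y *\<^sub>v w) = kronecker X Y *\<^sub>v w"
    if X: "X \<in> carrier_mat nA nA" and Y: "Y \<in> carrier_mat nB nB" and w: "w \<in> carrier_vec n" for X Y w
    using assoc_mult_mat_vec[OF onB[OF Y] onA[OF X] w] assoc_mult_mat_vec[OF onA[OF X] onB[OF Y] w]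
      kronecker_mult[OF one_carrier_mat Y X one_carrier_mat] kronecker_mult[OF X one_carrier_mat one_carrier_mat Y] X Y
    unfolding onA_def onB_def by simp_all
  have afterF: "vsum (\<lambda>f. F h f \<cdot>\<^sub>v (onA (U f) *\<^sub>v ((if f = f' then s else 0) \<cdot>\<^sub>v \<Psi>))) = (F h f' * s) \<cdot>\<^sub>v (onA (U f') *\<^sub>v \<Psi>)"
    if f': "f' \<in> carrier G" for f'
  proof -
    have c: "onA (U f) *\<^sub>v \<Psi> \<in> carrier_vec n" if "f \<in> carrier G" for f
      using onA[OF RU(1)[OF that]] \<Psi>' by simp
    have zero: "0 \<cdot>\<^sub>v v = 0\<^sub>v n" if "v \<in> carrier_vec n" for v :: "complex vec"
      using that by (intro eq_vecI) auto
    have "onA (U f) *\<^sub>v ((if f = f' then s else 0) \<cdot>\<^sub>v \<Psi>) = (if f = f' then s \<cdot>\<^sub>v (onA (U f') *\<^sub>v \<Psi>) else 0\<^sub>v n)"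
      if f: "f \<in> carrier G" for f
      using mult_mat_vec[OF onA[OF RU(1)[OF f]] \<Psi>'] zero[OF c[OF f]] by auto
    then have "vsum (\<lambda>f. F h f \<cdot>\<^sub>v (onA (U f) *\<^sub>v ((if f = f' then s else 0) \<cdot>\<^sub>v \<Psi>)))
      = vsum (\<lambda>f. F h f \<cdot>\<^sub>v (if f = f' then s \<cdot>\<^sub>v (onA (U f') *\<^sub>v \<Psi>) else 0\<^sub>v n))"
      unfolding vsum_def by (intro finsum_vec_cong) (use c[OF f'] in auto)
    also have "\<dots> = F h f' \<cdot>\<^sub>v (s \<cdot>\<^sub>v (onA (U f') *\<^sub>v \<Psi>))"
      unfolding vsum_def by (rule finsum_vec_delta[OF f']) (use c[OF f'] in simp)
    finally show ?thesis by (simp add: smult_smult_assoc)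
  qed
  define t where "t = z * s"
  define w where "w = t \<cdot>\<^sub>v \<Psi>"
  have w: "w \<in> carrier_vec n" using \<Psi>' by (simp add: w_def)
  let ?LC = "op_combination G n T (C g)"
  have inner: "onB (V f') *\<^sub>v ((z * inverse (F h f')) \<cdot>\<^sub>v
      vsum (\<lambda>f. F h f \<cdot>\<^sub>v (onA (U f) *\<^sub>v ((if f = f' then s else 0) \<cdot>\<^sub>v \<Psi>)))) = T f' *\<^sub>v w"
    if f': "f' \<in> carrier G" for f'
  proof -
    \<comment> \<open>The prescribed magnitude makes the entry invertible, so the factor in
      \<open>Z(h)\<close> really cancels it.\<close>
    have "cmod (F h f') > 0"
      using F h f' order_pos unfolding admissible_ancilla_gates_def by simp
    then have "z * inverse (F h f') * (F h f' * s) = t" by (simp add: t_def)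
    then have "(z * inverse (F h f')) \<cdot>\<^sub>v ((F h f' * s) \<cdot>\<^sub>v (onA (U f') *\<^sub>v \<Psi>)) = onA (U f') *\<^sub>v w"
      unfolding w_def mult_mat_vec[OF onA[OF RU(1)[OF f']] \<Psi>'] smult_smult_assoc by (rule arg_cong)
    then show ?thesis
      unfolding afterF[OF f'] using onBA[OF RU(1)[OF f'] RV(1)[OF f'] w] by (simp add: T_def)
  qed
  have "protocol_branch G nA nB U V F z C h g \<Psi> = onA (mat_adjoint (U g)) *\<^sub>v (onB (mat_adjoint (V g)) *\<^sub>v
      vsum (\<lambda>f'. C g f' \<cdot>\<^sub>v (onB (V f') *\<^sub>v ((z * inverse (F h f')) \<cdot>\<^sub>v
        vsum (\<lambda>f. F h f \<cdot>\<^sub>v (onA (U f) *\<^sub>v ((if f = f' then s else 0) \<cdot>\<^sub>v \<Psi>)))))))"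
    unfolding protocol_branch_def Let_def onA_def onB_def vsum_def s_def n_def ..
  also have "vsum (\<lambda>f'. C g f' \<cdot>\<^sub>v (onB (V f') *\<^sub>v ((z * inverse (F h f')) \<cdot>\<^sub>v
        vsum (\<lambda>f. F h f \<cdot>\<^sub>v (onA (U f) *\<^sub>v ((if f = f' then s else 0) \<cdot>\<^sub>v \<Psi>))))))
      = vsum (\<lambda>f'. C g f' \<cdot>\<^sub>v (T f' *\<^sub>v w))"
    unfolding vsum_def
  proof (rule finsum_vec_cong)
    fix f' assume f': "f' \<in> carrier G"
    show "C g f' \<cdot>\<^sub>v (T f' *\<^sub>v w) \<in> carrier_vec n"
      using mult_mat_vec_carrier[OF RT(1)[OF f'] w] by simp
  qed (simp only: inner[unfolded vsum_def])
  also have "\<dots> = ?LC *\<^sub>v w"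
    unfolding vsum_def by (rule op_combination_mult_vec[OF RT(1) w])
  \<comment> \<open>The correction on \<open>A\<close> and the controlled adjoint on
    \<open>B\<close> combine to the adjoint of \<open>T g\<close>.\<close>
  also have "onA (mat_adjoint (U g)) *\<^sub>v (onB (mat_adjoint (V g)) *\<^sub>v (?LC *\<^sub>v w))
      = mat_adjoint (T g) *\<^sub>v (?LC *\<^sub>v w)"
    unfolding T_def mat_adjoint_kronecker
    by (rule onAB[OF RU(6)[OF g] RV(6)[OF g]]) (rule mult_mat_vec_carrier[OF op_combination_carrier w])
  also have "\<dots> = mat_adjoint (T g) * ?LC *\<^sub>v w"
    by (rule assoc_mult_mat_vec[OF RT(6)[OF g] op_combination_carrier w, symmetric])
  also have "\<dots> = op_combination G n T c *\<^sub>v w"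
    unfolding C_def adjoint_mult_coeff_row[OF T g] ..
  also have "\<dots> = t \<cdot>\<^sub>v (op_combination G n T c *\<^sub>v \<Psi>)"
    unfolding w_def by (rule mult_mat_vec[OF op_combination_carrier \<Psi>'])
  finally show ?thesis unfolding C_def t_def s_def n_def .
qed

end

theorem theorem7:
  fixes G :: "('g, 'x) monoid_scheme"
    and nA nB \<kappa> :: nat
    and U V :: "'g \<Rightarrow> complex mat"
    and \<mu> \<nu> \<gamma> :: "'g \<Rightarrow> 'g \<Rightarrow> complex"
    and d :: "nat \<Rightarrow> nat"
    and D :: "nat \<Rightarrow> 'g \<Rightarrow> complex mat"
    and c :: "'g \<Rightarrow> complex"
    and T :: "'g \<Rightarrow> complex mat"
    and \<U> :: "complex mat"
  assumes "group G" and "finite (carrier G)"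
    and "nA > 0" and "nB > 0"
    and "proj_unitary_rep G nA \<mu> U" and "U \<one>\<^bsub>G\<^esub> = 1\<^sub>m nA"
    and "proj_unitary_rep G nB \<nu> V" and "V \<one>\<^bsub>G\<^esub> = 1\<^sub>m nB"
    and "\<gamma> = (\<lambda>f g. \<mu> f g * \<nu> f g)"
    and "complete_irreps G \<gamma> \<kappa> d D"
    and "T = (\<lambda>f. kronecker (U f) (V f))"
    and "\<U> = op_combination G (nA * nB) T c"
  shows
    "((unitary_coeff_operator G \<gamma> c \<longleftrightarrow> unitary_irrep_expansion G \<kappa> d D c) \<and>
      (unitary_irrep_expansion G \<kappa> d D c \<longleftrightarrow> orthonormal_coeffs G \<gamma> c))
   \<and> (unitary_coeff_operator G \<gamma> c \<or> unitary_irrep_expansion G \<kappa> d D c \<or> orthonormal_coeffs G \<gamma> c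
        \<longrightarrow> unitary_mat (nA * nB) \<U> \<and>
            (\<forall>F z. admissible_ancilla_gates G F z \<longrightarrow>
               deterministically_implements G nA nB U V F z (coeff_operator G \<gamma> c) \<U>))
   \<and> (unitary_mat (nA * nB) \<U> \<and> lin_indep_ops G (nA * nB) T
        \<longrightarrow> unitary_coeff_operator G \<gamma> c \<and> unitary_irrep_expansion G \<kappa> d D c \<and>
            orthonormal_coeffs G \<gamma> c)
   \<and> (unitary_mat (nA * nB) \<U> \<and> \<not> lin_indep_ops G (nA * nB) T
        \<longrightarrow> (\<exists>c'. \<U> = op_combination G (nA * nB) T c' \<and>
                  unitary_coeff_operator G \<gamma> c' \<and> unitary_irrep_expansion G \<kappa> d D c' \<and>
                  orthonormal_coeffs G \<gamma> c'))"
proof -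
  interpret finite_group G
    using assms(1,2) by (simp add: finite_group_def finite_group_axioms_def)
  let ?n = "nA * nB"
  have T: "proj_unitary_rep G ?n \<gamma> T"
    unfolding \<open>\<gamma> = _\<close> \<open>T = _\<close> by (rule proj_unitary_rep_kronecker[OF assms(5,7)])
  have one: "T \<one>\<^bsub>G\<^esub> = 1\<^sub>m ?n"
    using assms(6,8) by (simp add: \<open>T = _\<close> kronecker_one)
  have n: "?n > 0" using assms(3,4) by simp
  note complete = \<open>complete_irreps G \<gamma> \<kappa> d D\<close>
  \<comment> \<open>Condition (iii) is the hub to which the other two are reduced. Both equivalences
    are stated for an arbitrary \<open>c\<close> because (d) applies them to the modified
    coefficients.\<close>
  have i_iii: "unitary_coeff_operator G \<gamma> c \<longleftrightarrow> orthonormal_coeffs G \<gamma> c" for c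
    by (rule unitary_coeff_operator_iff[OF T n one])
  have ii_iii: "unitary_irrep_expansion G \<kappa> d D c \<longleftrightarrow> orthonormal_coeffs G \<gamma> c" for c
    unfolding unitary_irrep_expansion_iff[OF T n complete]
      orthonormal_coeffs_iff_unitary_irreps[OF T n one complete] ..
  have unit: "unitary_mat ?n \<U>" if "orthonormal_coeffs G \<gamma> c"
    unfolding \<open>\<U> = _\<close> by (rule orthonormal_coeffs_imp_unitary[OF T one that])
  have protocol: "deterministically_implements G nA nB U V F z (coeff_operator G \<gamma> c) \<U>"
    if "admissible_ancilla_gates G F z" for F z
    unfolding deterministically_implements_def \<open>\<U> = _\<close>
    using protocol_branch_eq[OF assms(5,7) that, where c = c, folded \<open>\<gamma> = _\<close> \<open>T = _\<close>] by blast
  have indep: "orthonormal_coeffs G \<gamma> c" if "unitary_mat ?n \<U>" "lin_indep_ops G ?n T"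
  proof -
    \<comment> \<open>Unitarity equates two combinations; independence then forces their coefficient
      functions, the correlation and the delta, to agree.\<close>
    have "op_combination G ?n T (correlation \<gamma> c) = op_combination G ?n T (\<lambda>g. if g = \<one>\<^bsub>G\<^esub> then 1 else 0)"
      using that(1) unfolding \<open>\<U> = _\<close> unitary_mat_op_combination_iff[OF T]
        op_combination_delta_one[where E = T, OF one] .
    then have "\<forall>g\<in>carrier G. correlation \<gamma> c g - (if g = \<one>\<^bsub>G\<^esub> then 1 else 0) = 0"
      using that(2) unfolding op_combination_eq_iff lin_indep_ops_def by blast
    then show ?thesis unfolding orthonormal_coeffs_iff by simp
  qed
  have dep: "\<exists>c'. \<U> = op_combination G ?n T c' \<and> orthonormal_coeffs G \<gamma> c'" if unit: "unitary_mat ?n \<U>"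
  proof -
    obtain c' where "op_combination G ?n T c' = op_combination G ?n T c" "orthonormal_coeffs G \<gamma> c'"
      by (rule exists_orthonormal_coeffs[OF T n one complete unit[unfolded \<open>\<U> = _\<close>]])
    then show ?thesis unfolding \<open>\<U> = _\<close> by metis
  qed
  show ?thesis
    unfolding i_iii ii_iii using unit protocol indep dep by simp
qed

end
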